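(* Let $r,m,\ell\geq 1$, let $\mathfrak q_1,\dots,\mathfrak q_\ell\in A=\mathbb F_q[T]$ be distinct monic irreducible polynomials of degree $m$, none equal to $T$, and let $\phi$ be the Drinfeld module over $k=\mathbb F_{q^r}$ (with $T\mapsto0$) given by $\phi_T=\tau^r$. Put $R=\mathbb F_{q^r}\{\tau\}$, $Q_i=\mathfrak q_i(\tau^r)$, $\Gamma=(Q_1,\dots,Q_\ell)$, $P=\prod_i\mathfrak q_i$, $\Pi=P(\tau^r)=\prod_iQ_i$, $\mathsf N=\deg_\tau(\Pi)=m\ell r$. Then: (1) The elements $Q_1,\dots,Q_\ell$ are central in $R$ and pairwise coprime, and $$\Pi=\operatorname{lclm}(Q_1,\dots,Q_\ell),\qquad \deg_\tau(\Pi)=\sum_i\deg_\tau(Q_i).$$ Thus $\Gamma$ is $\Pi$-independent. (2) For each $i$, restriction to $\mathfrak q_i$-torsion induces an isomorphism $$\Theta_i:R/(Q_i)\xrightarrow{\ \sim\ }\operatorname{End}_{A/(\mathfrak q_i)}(\phi[\mathfrak q_i])\cong\operatorname{Mat}_{r\times r}(\mathbb F_{q^m}).$$ (3) Put $\mathcal R_\Gamma=\prod_{i=1}^\ell R/(Q_i)$. The map $\operatorname{CRT}_\Gamma:R/(\Pi)\to\mathcal R_\Gamma$, $u\mapsto(\operatorname{rem}_r(u,Q_i))_i$, is an isomorphism (the skew Chinese remainder theorem). For $1\le K\le\mathsf N$, the set $\operatorname{SCRT}_{\Gamma,K}=\{\operatorname{CRT}_\Gamma(u):u\in R,\ \deg_\tau(u)<K\}$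 is an $\mathbb F_{q^r}$-linear code of dimension $K$ (with respect to left multiplication by $\mathbb F_{q^r}$). (4) Let $\Theta:\mathcal R_\Gamma\xrightarrow{\sim}\operatorname{Mat}_{r\times r}(\mathbb F_{q^m})^\ell$, $(y_i)_i\mapsto(\Theta_i(y_i))_i$. For every integer $t$ with $1\le t\le\ell r$, with $s=tm-1$, $$\Theta(\operatorname{SCRT}_{\Gamma,mt})=\mathcal C^{\mathrm{MSRD}}_{s,\mathfrak q_1,\dots,\mathfrak q_\ell},$$ where $\mathcal C^{\mathrm{MSRD}}_{s,\mathfrak q_1,\dots,\mathfrak q_\ell}=\{(u|_{\phi[\mathfrak q_1]},\dots,u|_{\phi[\mathfrak q_\ell]}):u\in\operatorname{End}_k(\phi),\ u=0\text{ or }\deg_\tau(u)\le s\}\subseteq\operatorname{Mat}_{r\times r}(\mathbb F_{q^m})^\ell$.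
   Context: $q$ is a prime power. $R=\mathbb F_{q^r}\{\tau\}$ is the skew polynomial ring with $\tau\alpha=\alpha^q\tau$ for $\alpha\in\mathbb F_{q^r}$; it is Euclidean on both sides. An element $\sum a_i\tau^i$ acts on an algebraic closure $\overline k$ by $x\mapsto\sum a_ix^{q^i}$, and multiplication corresponds to composition. For $F,G\in R$, $G$ monic, $\operatorname{rem}_r(F,G)$ denotes the unique $H$ with $F=BG+H$, $\deg_\tau(H)<\deg_\tau(G)$ (right Euclidean division). $\operatorname{lclm}$ is the monic least common left multiple; coprime means the greatest common right divisor is $1$. "$\Pi$-independent" is terminology from the literature on skew CRT codes; it is used here for a tuple of moduli whose least common left multiple is $\Pi$ and whose degrees sum to $\deg_\tau(\Pi)$, that is, for the two equalities displayed in part (1). Since the $Q_i$ and $\Pi$ are central, $(Q_i)=RQ_i$ and $(\Pi)=R\Pi$ are two-sided ideals and the quotients are rings; each class in $R/(Q_i)$ is identified with its unique right-remainder representative of degree less than $mr$, and residue-class notation is suppressed in the arguments of $\operatorname{CRT}_\Gamma$. The Drinfeld module $\phi$ is the $\mathbb F_q$-algebra homomorphism $A\to k\{\tau\}$, $a\mapsto\phi_a=a(\tau^r)$. $\operatorname{End}_k(\phi)=\{u\in k\{\tau\}:u\phi_a=\phi_au\ \forall a\in A\}=R$. For nonzero $a\in A$, $\phi[a]=\{\alpha\in\overline k:\phi_a(\alpha)=0\}$, an $A$-module via $b\cdot\alpha=\phi_b(\alpha)$; $\phi[\mathfrak q_i]\cong(A/\mathfrak q_i)^r\cong\mathbb F_{q^m}^r$,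 endomorphisms act $A/\mathfrak q_i$-linearly on it, and for each $i$ an isomorphism $A/\mathfrak q_i\cong\mathbb F_{q^m}$ and a basis of $\phi[\mathfrak q_i]$ are fixed to represent these actions as matrices. *)

theory Defs
  imports
    "HOL-Algebra.Algebraic_Closure_Type"
    "HOL-Algebra.Chinese_Remainder"
    "HOL-Library.Cardinality"
    "Jordan_Normal_Form.VS_Connect"
begin

hide_const (open) Multiset.mult Polynomial.smult Modules.module
  Polynomials.degree Polynomials.lead_coeff up_ring.coeff up_ring.monom
  Divisibility.irreducible

section \<open>Skew polynomials\<close>

text \<open>
  The type \<^typ>\<open>'k poly\<close> only serves as the type of finite coefficient sequences:
  \<^term>\<open>monom a i\<close> stands for \<open>a \<tau>\<^sup>i\<close> and \<^const>\<open>degree\<close> is the degree in \<open>\<tau>\<close>, except that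
  the zero element has degree \<open>0\<close> here.  The multiplication is the twisted one, determined by
  \<open>\<tau> a = a\<^sup>q \<tau>\<close>; the commutative product \<open>(*)\<close> on \<^typ>\<open>'k poly\<close> is never used for it.
\<close>

definition skew_mult :: "nat \<Rightarrow> 'k::field poly \<Rightarrow> 'k poly \<Rightarrow> 'k poly" where
  "skew_mult q f g =
     (\<Sum>i\<le>degree f. \<Sum>j\<le>degree g. monom (coeff f i * coeff g j ^ (q ^ i)) (i + j))"

definition skew_ring :: "nat \<Rightarrow> 'k::field poly ring" where
  "skew_ring q = \<lparr>carrier = UNIV, mult = skew_mult q, one = 1, zero = 0, add = (+)\<rparr>"

lemma skew_mult_monom:
  "0 < q \<Longrightarrow> skew_mult q (monom a i) (monom b j) = monom (a * b ^ (q ^ i)) (i + j)"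
proof -
  assume q: "0 < q"
  have A: "(\<Sum>i'\<le>degree (monom a i). \<Sum>j'\<le>degree (monom b j).
     monom (coeff (monom a i) i' * coeff (monom b j) j' ^ (q ^ i')) (i' + j')) = monom (a * b ^ (q ^ i)) (i + j)"
    if "a \<noteq> 0" "b \<noteq> 0"
  proof -
    have "(\<Sum>i'\<le>degree (monom a i). \<Sum>j'\<le>degree (monom b j).
       monom (coeff (monom a i) i' * coeff (monom b j) j' ^ (q ^ i')) (i' + j'))
       = (\<Sum>i'\<le>i. \<Sum>j'\<le>j. if i' = i then (if j' = j then monom (a * b ^ (q ^ i)) (i + j) else 0) else 0)"
      using that q by (intro sum.cong) (auto simp: degree_monom_eq zero_power)
    also have "\<dots> = (\<Sum>i'\<le>i. if i' = i then monom (a * b ^ (q ^ i)) (i + j) else 0)"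
      by (intro sum.cong) auto
    finally show ?thesis by simp
  qed
  show ?thesis
    using A q by (cases "a = 0 \<or> b = 0") (auto simp: skew_mult_def zero_power)
qed

definition right_dvd :: "nat \<Rightarrow> 'k::field poly \<Rightarrow> 'k poly \<Rightarrow> bool" where
  "right_dvd q G F \<longleftrightarrow> (\<exists>B. F = skew_mult q B G)"

definition rem_r :: "nat \<Rightarrow> 'k::field poly \<Rightarrow> 'k poly \<Rightarrow> 'k poly" where
  "rem_r q F G =
     (THE H. (\<exists>B. F = skew_mult q B G + H) \<and> (H = 0 \<or> degree H < degree G))"

definition is_gcrd :: "nat \<Rightarrow> 'k::field poly \<Rightarrow> 'k poly \<Rightarrow> 'k poly \<Rightarrow> bool" where
  "is_gcrd q D F G \<longleftrightarrow> lead_coeff D = 1 \<and> right_dvd q D F \<and> right_dvd q D G \<and>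
     (\<forall>E. right_dvd q E F \<and> right_dvd q E G \<longrightarrow> right_dvd q E D)"

definition skew_coprime :: "nat \<Rightarrow> 'k::field poly \<Rightarrow> 'k poly \<Rightarrow> bool" where
  "skew_coprime q F G \<longleftrightarrow> is_gcrd q 1 F G"

definition is_lclm :: "nat \<Rightarrow> 'k::field poly \<Rightarrow> 'k poly list \<Rightarrow> bool" where
  "is_lclm q L Gs \<longleftrightarrow> lead_coeff L = 1 \<and> (\<forall>G\<in>set Gs. right_dvd q G L) \<and>
     (\<forall>M. (\<forall>G\<in>set Gs. right_dvd q G M) \<longrightarrow> right_dvd q L M)"

definition independent_moduli :: "nat \<Rightarrow> 'k::field poly \<Rightarrow> 'k poly list \<Rightarrow> bool" where
  "independent_moduli q L Gs \<longleftrightarrow> is_lclm q L Gs \<and> degree L = (\<Sum>G\<leftarrow>Gs. degree G)"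

text \<open>
  The set \<^term>\<open>PIdl\<^bsub>skew_ring q\<^esub> G\<close> is the left ideal \<open>R G\<close>; for central \<open>G\<close> it is the
  two-sided ideal \<open>(G)\<close>.
\<close>

abbreviation skew_quot :: "nat \<Rightarrow> 'k::field poly \<Rightarrow> 'k poly set ring" where
  "skew_quot q G \<equiv> skew_ring q Quot (PIdl\<^bsub>skew_ring q\<^esub> G)"

abbreviation skew_class :: "nat \<Rightarrow> 'k::field poly \<Rightarrow> 'k poly \<Rightarrow> 'k poly set" where
  "skew_class q G u \<equiv> PIdl\<^bsub>skew_ring q\<^esub> G +>\<^bsub>skew_ring q\<^esub> u"

definition skew_act :: "nat \<Rightarrow> 'k::field poly \<Rightarrow> 'k alg_closure \<Rightarrow> 'k alg_closure" where
  "skew_act q u x = (\<Sum>i\<le>degree u. to_ac (coeff u i) * x ^ (q ^ i))"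


section \<open>The Drinfeld module and its torsion\<close>

text \<open>
  The embedding \<open>\<iota>\<close> of \<open>\<bbbF>\<^sub>q\<close> into the field with \<open>q\<^sup>r\<close> elements is explicit, and the polynomial ring
  \<open>A\<close> over \<open>\<bbbF>\<^sub>q\<close> is \<^typ>\<open>'f poly\<close>.  Below, \<^term>\<open>drinfeld \<iota> r a\<close> is \<open>a(\<tau>\<^sup>r)\<close>.
\<close>

definition drinfeld :: "('f::field \<Rightarrow> 'k::field) \<Rightarrow> nat \<Rightarrow> 'f poly \<Rightarrow> 'k poly" where
  "drinfeld \<iota> r a = (\<Sum>i\<le>degree a. monom (\<iota> (coeff a i)) (r * i))"

lemma power_card_eq: "x ^ CARD('f) = x" for x :: "'f::{field,finite}"
proof (cases "x = 0")
  case False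
  let ?S = "UNIV - {0::'f}"
  have "bij_betw (\<lambda>y. x * y) ?S ?S"
    by (rule bij_betwI[where g = "\<lambda>y. y / x"]) (use False in auto)
  from prod.reindex_bij_betw[OF this, of "\<lambda>y. y"]
  have "prod (\<lambda>y. y) ?S = prod (\<lambda>y. x * y) ?S" by (rule sym)
  also have "\<dots> = x ^ card ?S * prod (\<lambda>y. y) ?S" by (simp add: prod.distrib)
  finally have "prod (\<lambda>y. y) ?S = x ^ card ?S * prod (\<lambda>y. y) ?S" .
  moreover have "prod (\<lambda>y. y) ?S \<noteq> 0" by (subst prod_zero_iff) auto
  ultimately have "x ^ card ?S = 1" by (simp only: mult_cancel_right1 simp_thms)
  moreover have "insert 0 ?S = UNIV" by auto
  hence "Suc (card ?S) = CARD('f)"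
    using card_insert_disjoint[of ?S "0::'f"] by simp
  ultimately show ?thesis
    using power_Suc[of x "card ?S"] by (simp only: mult_1_right)
qed (simp add: zero_power)

lemma drinfeld_eq_pcompose:
  assumes "field_hom \<iota>"
  shows "drinfeld \<iota> r a = pcompose (map_poly \<iota> a) (monom 1 r)"
proof -
  interpret field_hom \<iota> by fact
  show ?thesis
    by (simp add: drinfeld_def pcompose_altdef poly_altdef coeff_map_poly degree_map_poly
        monom_power smult_monom)
qed

lemma drinfeld_T:
  assumes "field_hom \<iota>"
  shows "drinfeld \<iota> r [:0, 1:] = monom 1 r"
proof -
  interpret field_hom \<iota> by fact
  show ?thesis using assms by (simp add: drinfeld_eq_pcompose pcompose_pCons map_poly_pCons)
qed

lemma drinfeld_const: "drinfeld \<iota> r [:c:] = [:\<iota> c:]"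
  by (simp add: drinfeld_def monom_0)

lemma drinfeld_ring_hom:
  assumes "field_hom (\<iota> :: 'f::{field,finite} \<Rightarrow> 'k::field)"
  shows "drinfeld \<iota> r \<in> Ring.ring_hom class_ring (skew_ring CARD('f))"
proof -
  interpret field_hom \<iota> by fact
  have fixed: "coeff (drinfeld \<iota> r a) j ^ (CARD('f) ^ i) = coeff (drinfeld \<iota> r a) j" for a i j
  proof (induction i)
    case (Suc i)
    have "coeff (drinfeld \<iota> r a) j \<in> range \<iota>"
    proof -
      have "coeff (drinfeld \<iota> r a) j = \<iota> (\<Sum>i\<le>degree a. if r * i = j then coeff a i else 0)"
        by (simp add: drinfeld_def coeff_sum hom_sum if_distrib cong: if_cong)
      thus ?thesis by blast
    qed
    then obtain c where c: "coeff (drinfeld \<iota> r a) j = \<iota> c" by blast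
    have "coeff (drinfeld \<iota> r a) j ^ CARD('f) = coeff (drinfeld \<iota> r a) j"
      by (simp only: c hom_power[symmetric] power_card_eq)
    thus ?case using Suc by (simp add: power_mult)
  qed simp
  have mult: "skew_mult CARD('f) f (drinfeld \<iota> r b) = f * drinfeld \<iota> r b" for f b
  proof -
    have "f * drinfeld \<iota> r b = (\<Sum>i\<le>degree f. monom (coeff f i) i) *
        (\<Sum>j\<le>degree (drinfeld \<iota> r b). monom (coeff (drinfeld \<iota> r b) j) j)"
      by (simp add: poly_as_sum_of_monoms)
    also have "\<dots> = skew_mult CARD('f) f (drinfeld \<iota> r b)"
      by (simp add: skew_mult_def fixed sum_product mult_monom)
    finally show ?thesis by simp
  qed
  have "map_poly \<iota> (a * b) = map_poly \<iota> a * map_poly \<iota> b" for a b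
    by (rule poly_eqI) (simp only: coeff_map_poly hom_zero coeff_mult hom_sum hom_mult)
  moreover have "map_poly \<iota> (a + b) = map_poly \<iota> a + map_poly \<iota> b" for a b
    by (rule poly_eqI) (simp only: coeff_map_poly hom_zero coeff_add hom_add)
  ultimately have "drinfeld \<iota> r (a * b) = drinfeld \<iota> r a * drinfeld \<iota> r b"
      "drinfeld \<iota> r (a + b) = drinfeld \<iota> r a + drinfeld \<iota> r b" for a b
    by (simp_all only: drinfeld_eq_pcompose[OF assms] pcompose_mult pcompose_add)
  moreover have "drinfeld \<iota> r 1 = 1"
    by (simp add: drinfeld_def)
  ultimately show ?thesis
    by (simp add: Ring.ring_hom_def skew_ring_def mult del: One_nat_def)
qed

definition drinfeld_End :: "nat \<Rightarrow> ('f::field \<Rightarrow> 'k::field) \<Rightarrow> nat \<Rightarrow> 'k poly set" where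
  "drinfeld_End q \<iota> r =
     {u. \<forall>a. skew_mult q u (drinfeld \<iota> r a) = skew_mult q (drinfeld \<iota> r a) u}"

definition torsion ::
    "nat \<Rightarrow> ('f::field \<Rightarrow> 'k::field) \<Rightarrow> nat \<Rightarrow> 'f poly \<Rightarrow> 'k alg_closure set" where
  "torsion q \<iota> r a = {x. skew_act q (drinfeld \<iota> r a) x = 0}"

abbreviation poly_quot :: "'f::field poly \<Rightarrow> 'f poly set ring" where
  "poly_quot a \<equiv> class_ring Quot (PIdl\<^bsub>class_ring\<^esub> a)"

text \<open>
  The \<open>a\<close>-torsion as a module over \<open>A/(a)\<close>: a residue class \<open>C\<close> acts as \<open>\<phi>\<^sub>b\<close> for any \<open>b \<in> C\<close>, so
  that the image below is a singleton.  The multiplication and unit fields of the record are not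
  part of the module structure.
\<close>

definition torsion_module ::
    "nat \<Rightarrow> ('f::field \<Rightarrow> 'k::field) \<Rightarrow> nat \<Rightarrow> 'f poly \<Rightarrow> ('f poly set, 'k alg_closure) module"
where
  "torsion_module q \<iota> r a =
     \<lparr>carrier = torsion q \<iota> r a, mult = (*), one = 1, zero = 0, add = (+),
      smult = (\<lambda>C x. the_elem ((\<lambda>b. skew_act q (drinfeld \<iota> r b) x) ` C))\<rparr>"

definition End_ring :: "('a, 'c) ring_scheme \<Rightarrow> ('a, 'b, 'd) module_scheme \<Rightarrow> ('b \<Rightarrow> 'b) ring" where
  "End_ring K M =
     \<lparr>carrier = module_hom K M M \<inter> extensional (carrier M),
      mult = compose (carrier M), one = (\<lambda>x\<in>carrier M. x),
      zero = (\<lambda>x\<in>carrier M. \<zero>\<^bsub>M\<^esub>), add = (\<lambda>f g. \<lambda>x\<in>carrier M. f x \<oplus>\<^bsub>M\<^esub> g x)\<rparr>"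

definition torsion_restrict ::
    "nat \<Rightarrow> ('f::field \<Rightarrow> 'k::field) \<Rightarrow> nat \<Rightarrow> 'f poly \<Rightarrow> 'k poly
       \<Rightarrow> 'k alg_closure \<Rightarrow> 'k alg_closure" where
  "torsion_restrict q \<iota> r a u = restrict (skew_act q u) (torsion q \<iota> r a)"

definition Theta_End ::
    "nat \<Rightarrow> ('f::field \<Rightarrow> 'k::field) \<Rightarrow> nat \<Rightarrow> 'f poly \<Rightarrow> 'k poly set
       \<Rightarrow> 'k alg_closure \<Rightarrow> 'k alg_closure" where
  "Theta_End q \<iota> r a C = the_elem (torsion_restrict q \<iota> r a ` C)"


section \<open>Matrices of endomorphisms\<close>

text \<open>
  The ordered basis \<open>bs\<close> is a distinct list, and \<open>\<chi>\<close> identifies the scalars \<open>K\<close> with \<^typ>\<open>'e\<close>.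
  Column \<open>j\<close> of the matrix of \<open>f\<close> holds the coordinates of the image of the \<open>j\<close>-th basis vector.
\<close>

definition coordinates ::
    "('a, 'c) ring_scheme \<Rightarrow> ('a, 'b, 'd) module_scheme \<Rightarrow> 'b list \<Rightarrow> 'b \<Rightarrow> 'b \<Rightarrow> 'a" where
  "coordinates K M bs v =
     (THE c. c \<in> set bs \<rightarrow>\<^sub>E carrier K \<and> module.lincomb M c (set bs) = v)"

definition matrix_of_endo ::
    "('a, 'c) ring_scheme \<Rightarrow> ('a, 'b, 'd) module_scheme \<Rightarrow> ('a \<Rightarrow> 'e) \<Rightarrow> 'b list
       \<Rightarrow> ('b \<Rightarrow> 'b) \<Rightarrow> 'e mat" where
  "matrix_of_endo K M \<chi> bs f =
     mat (length bs) (length bs) (\<lambda>(i, j). \<chi> (coordinates K M bs (f (bs ! j)) (bs ! i)))"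

abbreviation torsion_matrix ::
    "nat \<Rightarrow> ('f::field \<Rightarrow> 'k::field) \<Rightarrow> nat \<Rightarrow> 'f poly \<Rightarrow> ('f poly set \<Rightarrow> 'e) \<Rightarrow> 'k alg_closure list
       \<Rightarrow> ('k alg_closure \<Rightarrow> 'k alg_closure) \<Rightarrow> 'e mat" where
  "torsion_matrix q \<iota> r a \<equiv> matrix_of_endo (poly_quot a) (torsion_module q \<iota> r a)"


section \<open>Skew Chinese remainder codes\<close>

definition crt_ring :: "nat \<Rightarrow> 'k::field poly list \<Rightarrow> 'k poly set list ring" where
  "crt_ring q Gs = RDirProd_list (map (skew_quot q) Gs)"

definition crt_tuple :: "nat \<Rightarrow> 'k::field poly list \<Rightarrow> 'k poly \<Rightarrow> 'k poly set list" where
  "crt_tuple q Gs u = map (\<lambda>G. skew_class q G (rem_r q u G)) Gs"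

definition CRT :: "nat \<Rightarrow> 'k::field poly list \<Rightarrow> 'k poly set \<Rightarrow> 'k poly set list" where
  "CRT q Gs C = the_elem (crt_tuple q Gs ` C)"

text \<open>
  The product of the quotients as a left vector space over the coefficient field: a scalar \<open>c\<close> acts
  as left multiplication by the tuple of residue classes of the constant \<open>c\<close>.
\<close>

definition crt_space :: "nat \<Rightarrow> 'k::field poly list \<Rightarrow> ('k, 'k poly set list) module" where
  "crt_space q Gs =
     \<lparr>carrier = carrier (crt_ring q Gs), mult = mult (crt_ring q Gs),
      one = one (crt_ring q Gs), zero = zero (crt_ring q Gs), add = add (crt_ring q Gs),
      smult = (\<lambda>c Y. map (\<lambda>G. skew_class q G [:c:]) Gs \<otimes>\<^bsub>crt_ring q Gs\<^esub> Y)\<rparr>"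

text \<open>The side condition \<open>u = 0\<close> accounts for the convention that \<open>0\<close> has degree \<open>-\<infinity>\<close>.\<close>

definition SCRT :: "nat \<Rightarrow> 'k::field poly \<Rightarrow> 'k poly list \<Rightarrow> nat \<Rightarrow> 'k poly set list set" where
  "SCRT q L Gs K = {CRT q Gs (skew_class q L u) |u. u = 0 \<or> degree u < K}"

definition Theta ::
    "nat \<Rightarrow> ('f::field \<Rightarrow> 'k::field) \<Rightarrow> nat \<Rightarrow> 'f poly list \<Rightarrow> (nat \<Rightarrow> 'f poly set \<Rightarrow> 'e)
       \<Rightarrow> (nat \<Rightarrow> 'k alg_closure list) \<Rightarrow> 'k poly set list \<Rightarrow> 'e mat list" where
  "Theta q \<iota> r ps \<chi> bs Y =
     map (\<lambda>i. torsion_matrix q \<iota> r (ps ! i) (\<chi> i) (bs i) (Theta_End q \<iota> r (ps ! i) (Y ! i)))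
       [0..<length ps]"

definition MSRD ::
    "nat \<Rightarrow> ('f::field \<Rightarrow> 'k::field) \<Rightarrow> nat \<Rightarrow> 'f poly list \<Rightarrow> (nat \<Rightarrow> 'f poly set \<Rightarrow> 'e)
       \<Rightarrow> (nat \<Rightarrow> 'k alg_closure list) \<Rightarrow> nat \<Rightarrow> 'e mat list set" where
  "MSRD q \<iota> r ps \<chi> bs s =
     {map (\<lambda>i. torsion_matrix q \<iota> r (ps ! i) (\<chi> i) (bs i) (torsion_restrict q \<iota> r (ps ! i) u))
        [0..<length ps]
      |u. u \<in> drinfeld_End q \<iota> r \<and> (u = 0 \<or> degree u \<le> s)}"

end

theory Submission
  imports Defs
begin

text \<open>
  The elements \<open>\<phi>\<^sub>a\<close> have coefficients in \<open>\<bbbF>\<^sub>q\<close> and only involve powers of \<open>\<tau>\<^sup>r\<close>, so they are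
  central and skew multiplication by them is ordinary polynomial multiplication.  Hence right division
  by \<open>\<phi>\<^sub>a\<close>, the ideal \<open>(\<phi>\<^sub>a)\<close>, least common left multiples and the Chinese remainder theorem for the
  \<open>Q\<^sub>i\<close> reduce to their commutative counterparts, with Bezout identities transported along \<open>\<phi>\<close>.
  For \<open>a(0) \<noteq> 0\<close> the additive polynomial of \<open>\<phi>\<^sub>a\<close> is separable, so \<open>\<phi>[a]\<close> has \<open>q\<close> to the power
  \<open>deg\<^sub>\<tau> \<phi>\<^sub>a\<close> elements; a remainder modulo \<open>\<phi>\<^sub>a\<close> vanishing on all of them is zero.  Thus \<open>\<Theta>\<^sub>i\<close> is
  injective, and it is onto because source and target have equally many elements.
\<close>

section \<open>Frobenius powers and skew polynomials\<close>

text \<open>Agreement of the twisted and the commutative product has two separate sources: with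
  \<open>\<phi> a\<close> on the right, its coefficients are fixed by the q-th power map; with
  \<open>\<phi> a\<close> on the left, the twist is by powers of q^r, which fix the whole
  coefficient field. Finiteness replaces structure theory. That the torsion has rank r is not
  established in advance, and the order of its endomorphism ring is never computed. The given
  identification of A/(a) with a finite field makes A/(a) a field, the number of torsion points
  forces the given basis to have length r, and the composite from R/(Q_i) to matrices is an
  injection between two sets of q^(m r^2) elements. Since both factors are injective, surjectivity
  of the composite makes each of them onto. The dimension of a code is likewise read off from the
  number of its words. The maps out of quotients are encoded as the only element of the image of a
  coset, so each must be shown constant on cosets: multiples of \<open>\<phi> a\<close> kill the
  a-torsion, and multiples of the product of the Q_i lie in every (Q_i).\<close>

lemma frobenius_add:
  fixes h :: "'f::{field,finite} \<Rightarrow> 'a::field" and x y :: 'a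
  assumes "field_hom h"
  shows "(x + y) ^ CARD('f) = x ^ CARD('f) + y ^ CARD('f)"
proof (cases "y = 0")
  case True
  thus ?thesis by (simp add: zero_power)
next
  case False
  interpret field_hom h by fact
  let ?q = "CARD('f)"
  have q: "0 < ?q" by simp
  \<comment> \<open>With X the variable, \<open>P\<close> is (X + y)^q - X^q - y^q. The leading
    terms cancel, so its degree is below q, yet it vanishes at the q distinct points
    \<open>h c * y\<close> because c^q = c. Hence it is the zero polynomial.\<close>
  define P where "P = [:y, 1:] ^ ?q - monom 1 ?q - [:y ^ ?q:]"
  have "poly P (h c * y) = 0" for c
  proof -
    have "poly P (h c * y) = ((h (c + 1)) * y) ^ ?q - (h c * y) ^ ?q - y ^ ?q"
      by (simp add: P_def poly_monom hom_add distrib_right add.commute)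
    also have "\<dots> = (h ((c + 1) ^ ?q) - h (c ^ ?q) - 1) * y ^ ?q"
      by (simp only: power_mult_distrib hom_power algebra_simps mult_1_left mult_1_right)
    also have "\<dots> = 0"
      by (simp only: power_card_eq hom_add hom_one) simp
    finally show ?thesis .
  qed
  hence sub: "(\<lambda>c. h c * y) ` UNIV \<subseteq> {z. poly P z = 0}" by auto
  have "P = 0"
  proof (rule ccontr)
    assume P: "P \<noteq> 0"
    have "degree P \<le> ?q"
      unfolding P_def
      by (intro degree_diff_le order.trans[OF degree_power_le] order.trans[OF degree_monom_le]) auto
    moreover have "coeff P ?q = 0"
    proof -
      have deg: "degree ([:y, 1:] ^ ?q) = ?q" by (simp add: degree_power_eq)
      have "lead_coeff ([:y, 1:] ^ ?q) = 1" by (simp only: lead_coeff_power) simp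
      hence "coeff ([:y, 1:] ^ ?q) ?q = 1" by (simp only: deg)
      thus ?thesis using q by (simp add: P_def coeff_pCons split: nat.split)
    qed
    ultimately have "degree P < ?q"
      using P by (metis le_neq_implies_less leading_coeff_0_iff)
    moreover have "card ((\<lambda>c. h c * y) ` UNIV) = ?q"
      using False by (intro card_image inj_onI) auto
    moreover have "card ((\<lambda>c. h c * y) ` UNIV) \<le> card {z. poly P z = 0}"
      by (intro card_mono sub poly_roots_finite P)
    ultimately show False
      using card_poly_roots_bound[OF P] by linarith
  qed
  hence "poly P x = 0" by simp
  thus ?thesis by (simp add: P_def poly_monom algebra_simps)
qed

lemma frobenius_power_add:
  fixes h :: "'f::{field,finite} \<Rightarrow> 'a::field" and x y :: 'a
  assumes "field_hom h"
  shows "(x + y) ^ (CARD('f) ^ i) = x ^ (CARD('f) ^ i) + y ^ (CARD('f) ^ i)"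
  by (induction i)
    (simp_all add: power_Suc2 power_mult frobenius_add[OF assms] del: power_Suc)

lemma power_card_power_eq: "x ^ (CARD('f) ^ i) = x" for x :: "'f::{field,finite}"
  by (induction i) (simp_all add: power_mult power_card_eq)

lemma card_field_ge_2: "2 \<le> CARD('f::{field,finite})"
proof -
  have "card {0, 1 :: 'f} \<le> CARD('f)" by (intro card_mono) auto
  thus ?thesis by simp
qed

text \<open>The twisted product and the action on the closure are additive in each argument, so
  their laws only have to be checked on monomials; this rule performs the reduction.\<close>

lemma poly_monom_induct [case_names monom add]:
  fixes f :: "'a::comm_monoid_add poly"
  assumes "\<And>a i. P (monom a i)" "\<And>f g. P f \<Longrightarrow> P g \<Longrightarrow> P (f + g)"
  shows "P f"
proof -
  have "P (\<Sum>i\<in>A. monom (coeff f i) i)" if "finite A" for A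
    using that
  proof (induction A rule: finite_induct)
    case empty
    show ?case using assms(1)[of 0 0] by simp
  qed (simp add: assms)
  from this[of "{..degree f}"] show ?thesis by (simp add: poly_as_sum_of_monoms)
qed

text \<open>A root occurring twice in the factorization into linear factors would be a root of the
  derivative too. So the multiset of roots is a set, and its size is the degree.\<close>

lemma card_roots_pderiv_coprime:
  fixes P :: "'a::alg_closed_field poly"
  assumes "P \<noteq> 0" and "\<And>x. poly P x = 0 \<Longrightarrow> poly (pderiv P) x \<noteq> 0"
  shows "card {x. poly P x = 0} = degree P"
proof -
  obtain A where A: "size A = degree P" "P = Polynomial.smult (lead_coeff P) (\<Prod>x\<in>#A. [:-x, 1:])"
    using alg_closed_imp_factorization[OF assms(1)] by blast
  have "count A x \<le> 1" for x
  proof (rule ccontr)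
    assume "\<not> count A x \<le> 1"
    hence "{#x, x#} \<subseteq># A" by (auto simp: subseteq_mset_def)
    then obtain B where B: "A = {#x, x#} + B" by (rule mset_subset_eq_exists_conv[THEN iffD1, THEN exE])
    define S where "S = Polynomial.smult (lead_coeff P) (\<Prod>x\<in>#B. [:-x, 1:])"
    have "P = [:-x, 1:] * ([:-x, 1:] * S)"
      by (subst A(2)) (simp add: B S_def del: mult_pCons_left mult_pCons_right)
    hence "poly P x = 0" "poly (pderiv P) x = 0"
      by (simp_all add: pderiv_mult pderiv_pCons del: mult_pCons_left mult_pCons_right)
    thus False using assms(2) by blast
  qed
  hence "A = mset_set (set_mset A)"
    by (intro multiset_eqI) (metis count_mset_set(1,3) finite_set_mset le_antisym less_one linorder_not_less not_in_iff)
  moreover have "set_mset A = {x. poly P x = 0}"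
    by (subst A(2)) (use assms(1) in \<open>auto simp: poly_prod_mset\<close>)
  ultimately show ?thesis using A(1) by (metis size_mset_set)
qed

section \<open>Ring laws of the twisted product\<close>

locale finite_drinfeld =
  fixes q :: nat and \<iota> :: "'f::{field,finite} \<Rightarrow> 'k::{field,finite}" and r :: nat
  assumes q_eq: "q = CARD('f)" and field_hom: "field_hom \<iota>"
    and card_k: "CARD('k) = q ^ r" and r_pos: "1 \<le> r"
begin

lemma q_ge_2: "2 \<le> q" and q_pos [simp]: "0 < q"
  using card_field_ge_2[where 'f = 'f] by (simp_all add: q_eq)

abbreviation skew_times (infixl "\<star>" 70) where "skew_times \<equiv> skew_mult q :: 'k poly \<Rightarrow> 'k poly \<Rightarrow> 'k poly"

sublocale \<iota>: field_hom \<iota> by (rule field_hom)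

text \<open>The embedding of F_q into the algebraic closure through which additivity of the q-th
  power becomes available there.\<close>

lemma field_hom_ac: "field_hom (\<lambda>c. to_ac (\<iota> c))"
  by unfold_locales (simp_all add: \<iota>.hom_add \<iota>.hom_mult)

text \<open>The degree of a sum can drop, so the ranges in the definition do not match when
  additivity is checked. Arbitrary upper bounds bring all terms to one range.\<close>

lemma skew_mult_eq:
  assumes "degree f \<le> n" "degree g \<le> m"
  shows "f \<star> g = (\<Sum>i\<le>n. \<Sum>j\<le>m. monom (coeff f i * coeff g j ^ (q ^ i)) (i + j))"
proof -
  have "(\<Sum>j\<le>degree g. monom (coeff f i * coeff g j ^ (q ^ i)) (i + j)) =
      (\<Sum>j\<le>m. monom (coeff f i * coeff g j ^ (q ^ i)) (i + j))" for i
    using assms(2) by (intro sum.mono_neutral_left) (auto simp: coeff_eq_0 zero_power)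
  moreover have "(\<Sum>i\<le>degree f. \<Sum>j\<le>m. monom (coeff f i * coeff g j ^ (q ^ i)) (i + j)) =
      (\<Sum>i\<le>n. \<Sum>j\<le>m. monom (coeff f i * coeff g j ^ (q ^ i)) (i + j))"
    using assms(1) by (intro sum.mono_neutral_left) (auto simp: coeff_eq_0)
  ultimately show ?thesis by (simp add: skew_mult_def)
qed

lemma skew_mult_add_left: "(f + f') \<star> g = f \<star> g + f' \<star> g"
proof -
  let ?n = "max (degree f) (degree f')"
  have "degree (f + f') \<le> ?n" by (rule degree_add_le_max)
  thus ?thesis
    by (simp add: skew_mult_eq[of _ ?n _ "degree g"] distrib_right add_monom[symmetric] sum.distrib)
qed

text \<open>Unlike additivity on the left, this depends on the twist being additive, that is, on the
  Frobenius identity in the coefficient field.\<close>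

lemma skew_mult_add_right: "f \<star> (g + g') = f \<star> g + f \<star> g'"
proof -
  let ?n = "max (degree g) (degree g')"
  have "degree (g + g') \<le> ?n" by (rule degree_add_le_max)
  thus ?thesis
    by (simp add: skew_mult_eq[of _ "degree f" _ ?n] distrib_left add_monom[symmetric] sum.distrib
        frobenius_power_add[OF field_hom, folded q_eq])
qed

lemma skew_mult_monom': "monom a i \<star> monom b j = monom (a * b ^ (q ^ i)) (i + j)"
  by (rule skew_mult_monom) simp

lemma skew_mult_0 [simp]: "0 \<star> f = 0" "f \<star> 0 = 0"
  using skew_mult_add_left[of 0 0 f] skew_mult_add_right[of f 0 0]
  by (simp_all only: add_0_left add_cancel_right_left)

lemma skew_mult_1 [simp]: "1 \<star> f = f" "f \<star> 1 = f"
proof -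
  show "1 \<star> f = f"
    by (induction f rule: poly_monom_induct)
      (simp_all add: skew_mult_monom' skew_mult_add_right flip: monom_eq_1)
  show "f \<star> 1 = f"
    by (induction f rule: poly_monom_induct)
      (simp_all add: skew_mult_monom' skew_mult_add_left flip: monom_eq_1)
qed

lemma skew_mult_const_left: "[:c:] \<star> f = Polynomial.smult c f"
proof -
  have "monom c 0 \<star> f = Polynomial.smult c f"
    by (induction f rule: poly_monom_induct)
      (simp_all add: skew_mult_monom' skew_mult_add_right smult_monom smult_add_right)
  thus ?thesis by (simp add: monom_0)
qed

text \<open>On monomials with coefficients a, b, c and exponents i, j, n, both sides are a b^(q^i)
  c^(q^(i+j)) \<tau>^(i+j+n).\<close>

lemma skew_mult_assoc: "f \<star> g \<star> h = f \<star> (g \<star> h)"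
proof (induction f rule: poly_monom_induct)
  case f: (monom a i)
  show ?case
  proof (induction g rule: poly_monom_induct)
    case g: (monom b j)
    show ?case
      by (induction h rule: poly_monom_induct)
        (simp_all add: skew_mult_monom' skew_mult_add_right power_mult_distrib power_add
          mult.assoc add.assoc mult.commute[of "q ^ i"] flip: power_mult)
  qed (simp add: skew_mult_add_left skew_mult_add_right)
qed (simp add: skew_mult_add_left)

lemma skew_mult_sum_left: "(\<Sum>x\<in>A. f x) \<star> g = (\<Sum>x\<in>A. f x \<star> g)"
  by (induction A rule: infinite_finite_induct) (simp_all add: skew_mult_add_left)

lemma skew_mult_sum_right: "g \<star> (\<Sum>x\<in>A. f x) = (\<Sum>x\<in>A. g \<star> f x)"
  by (induction A rule: infinite_finite_induct) (simp_all add: skew_mult_add_right)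

lemma skew_ring_simps [simp]:
  "carrier (skew_ring q) = (UNIV :: 'k poly set)" "mult (skew_ring q) = (\<star>)"
  "one (skew_ring q) = (1 :: 'k poly)" "zero (skew_ring q) = (0 :: 'k poly)"
  "add (skew_ring q) = ((+) :: 'k poly \<Rightarrow> _)"
  by (simp_all add: skew_ring_def)

lemma ring_skew_ring: "ring (skew_ring q :: 'k poly ring)"
proof (rule ringI)
  show "abelian_group (skew_ring q :: 'k poly ring)"
    by (rule abelian_groupI) (auto simp: algebra_simps intro: exI[of _ "- x" for x])
  show "monoid (skew_ring q :: 'k poly ring)"
    by (rule monoidI) (auto simp: skew_mult_assoc)
qed (auto simp: skew_mult_add_left skew_mult_add_right)

sublocale R: ring "skew_ring q :: 'k poly ring" by (rule ring_skew_ring)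

section \<open>The Drinfeld module\<close>

abbreviation \<phi> :: "'f poly \<Rightarrow> 'k poly" where "\<phi> \<equiv> drinfeld \<iota> r"

text \<open>\<open>q ^ (r * i)\<close> is the i-th power of the size of the coefficient field, so
  \<tau>^r commutes with all scalars.\<close>

lemma power_q_multiple_r: "a ^ (q ^ (r * i)) = a" for a :: 'k
  using power_card_power_eq[of a i] by (simp add: card_k power_mult)

lemma power_q_\<iota>: "\<iota> c ^ (q ^ i) = \<iota> c"
  by (simp only: \<iota>.hom_power[symmetric] q_eq power_card_power_eq)

lemma drinfeld_hom [simp]:
  "\<phi> (a * b) = \<phi> a \<star> \<phi> b" "\<phi> (a + b) = \<phi> a + \<phi> b" "\<phi> 1 = 1"
  using ring_hom_memE[OF drinfeld_ring_hom[OF field_hom, of r]] by (simp_all add: skew_ring_def q_eq)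

text \<open>The coefficients that \<tau> has to pass are those of \<open>\<phi> a\<close>; they lie
  in the image of \<open>\<iota>\<close> and are fixed by the twist.\<close>

lemma skew_mult_drinfeld: "u \<star> \<phi> a = u * \<phi> a"
proof (induction u rule: poly_monom_induct)
  case (monom b j)
  have "monom b j \<star> monom (\<iota> c) i = monom b j * monom (\<iota> c) i" for c i
    by (simp add: skew_mult_monom' mult_monom power_q_\<iota>)
  thus ?case by (simp add: drinfeld_def skew_mult_sum_right sum_distrib_left)
qed (simp_all add: skew_mult_add_left distrib_right)

text \<open>Now the coefficients of the arbitrary \<open>u\<close> are twisted, but only by powers
  of \<tau>^r, which leave every element of the coefficient field fixed. Comparing with the product
  on the other side gives centrality.\<close>

lemma drinfeld_skew_mult: "\<phi> a \<star> u = u * \<phi> a"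
proof (induction u rule: poly_monom_induct)
  case (monom b j)
  have "monom (\<iota> c) (r * i) \<star> monom b j = monom b j * monom (\<iota> c) (r * i)" for c i
    by (simp add: skew_mult_monom' mult_monom power_q_multiple_r mult.commute[of "\<iota> c"] add.commute)
  thus ?case by (simp add: drinfeld_def skew_mult_sum_left sum_distrib_left)
qed (simp_all add: skew_mult_add_right distrib_right)

lemma drinfeld_central: "\<phi> a \<star> u = u \<star> \<phi> a"
  by (simp add: skew_mult_drinfeld drinfeld_skew_mult)

lemma drinfeld_mult: "\<phi> (a * b) = \<phi> a * \<phi> b"
  by (simp add: skew_mult_drinfeld)

text \<open>Centrality of all \<open>\<phi> a\<close> makes every skew polynomial an endomorphism of
  the Drinfeld module, so that the two codes compared at the end are parametrized by the same
  polynomials.\<close>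

lemma drinfeld_End_eq: "drinfeld_End q \<iota> r = UNIV"
  by (simp add: drinfeld_End_def drinfeld_central)

lemma coeff_drinfeld: "coeff (\<phi> a) (r * i) = \<iota> (coeff a i)"
proof -
  have "coeff (\<phi> a) (r * i) = (\<Sum>j\<le>degree a. if j = i then \<iota> (coeff a j) else 0)"
    using r_pos by (simp add: drinfeld_def coeff_sum)
  thus ?thesis by (simp add: coeff_eq_0)
qed

lemma degree_drinfeld: "degree (\<phi> a) = r * degree a"
proof (cases "a = 0")
  case False
  show ?thesis
  proof (rule antisym)
    show "degree (\<phi> a) \<le> r * degree a"
      unfolding drinfeld_def
      by (intro degree_sum_le) (auto intro: order.trans[OF degree_monom_le])
    show "r * degree a \<le> degree (\<phi> a)"
      using False by (intro le_degree) (simp add: coeff_drinfeld)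
  qed
qed (simp add: drinfeld_def)

lemma lead_coeff_drinfeld: "lead_coeff (\<phi> a) = \<iota> (lead_coeff a)"
  by (simp add: degree_drinfeld coeff_drinfeld)

lemma drinfeld_eq_0_iff: "\<phi> a = 0 \<longleftrightarrow> a = 0"
  using lead_coeff_drinfeld[of a] by (metis \<iota>.hom_0_iff leading_coeff_0_iff)

section \<open>The action of skew polynomials on the algebraic closure\<close>

lemma skew_act_eq:
  fixes u :: "'k poly"
  assumes "degree u \<le> n"
  shows "skew_act q u x = (\<Sum>i\<le>n. to_ac (coeff u i) * x ^ (q ^ i))"
  unfolding skew_act_def using assms by (intro sum.mono_neutral_left) (auto simp: coeff_eq_0)

lemma skew_act_add_left: "skew_act q (u + v) x = skew_act q u x + skew_act q v x" for u v :: "'k poly"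
proof -
  let ?n = "max (degree u) (degree v)"
  have "degree (u + v) \<le> ?n" by (rule degree_add_le_max)
  thus ?thesis by (simp add: skew_act_eq[of _ ?n] distrib_right sum.distrib)
qed

lemma skew_act_add_right: "skew_act q u (x + y) = skew_act q u x + skew_act q u y" for u :: "'k poly"
  by (simp add: skew_act_def frobenius_power_add[OF field_hom_ac, folded q_eq] distrib_left sum.distrib)

lemma skew_act_0 [simp]: "skew_act q (0 :: 'k poly) x = 0" "skew_act q u 0 = 0" for u :: "'k poly"
  by (simp_all add: skew_act_def zero_power)

lemma skew_act_monom: "skew_act q (monom a i) x = to_ac a * x ^ (q ^ i)" for a :: 'k
proof -
  have "skew_act q (monom a i) x = (\<Sum>j\<le>i. if j = i then to_ac a * x ^ (q ^ i) else 0)"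
    by (subst skew_act_eq[OF degree_monom_le]) (intro sum.cong, auto)
  thus ?thesis by simp
qed

lemma skew_act_1 [simp]: "skew_act q (1 :: 'k poly) x = x"
  using skew_act_monom[of 1 0 x] by simp

text \<open>For monomials, a (b x^(q^j))^(q^i) = a b^(q^i) x^(q^(i+j)): the twist in the product is
  exactly what composition requires.\<close>

lemma skew_act_mult: "skew_act q (u \<star> v) x = skew_act q u (skew_act q v x)"
proof (induction u rule: poly_monom_induct)
  case u: (monom a i)
  show ?case
  proof (induction v rule: poly_monom_induct)
    case v: (monom b j)
    show ?case
      by (simp add: skew_mult_monom' skew_act_monom power_mult_distrib power_add mult.assoc
          mult.commute[of "q ^ i"] flip: power_mult)
  qed (simp add: skew_mult_add_right skew_act_add_left skew_act_add_right)
qed (simp add: skew_mult_add_left skew_act_add_left)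

lemma skew_act_minus: "skew_act q (- u) x = - skew_act q u x" for u :: "'k poly"
  by (simp add: skew_act_def sum_negf)

lemma skew_act_diff: "skew_act q (u - v) x = skew_act q u x - skew_act q v x" for u v :: "'k poly"
  using skew_act_add_left[of u "- v"] by (simp add: skew_act_minus)

section \<open>Torsion\<close>

text \<open>The additive polynomial of \<open>u\<close>, as an ordinary polynomial, so that the
  kernel of the action of \<open>u\<close> is a set of roots and can be counted.\<close>

definition linearized :: "'k poly \<Rightarrow> 'k alg_closure poly" where
  "linearized u = (\<Sum>i\<le>degree u. monom (to_ac (coeff u i)) (q ^ i))"

lemma poly_linearized: "poly (linearized u) x = skew_act q u x"
  by (simp add: linearized_def poly_sum poly_monom skew_act_def)

lemma coeff_linearized: "coeff (linearized u) (q ^ i) = to_ac (coeff u i)"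
proof -
  have "coeff (linearized u) (q ^ i) = (\<Sum>j\<le>degree u. if j = i then to_ac (coeff u j) else 0)"
    using q_ge_2 by (simp add: linearized_def coeff_sum power_inject_exp)
  thus ?thesis by (simp add: coeff_eq_0)
qed

lemma degree_linearized_le: "degree (linearized u) \<le> q ^ degree u"
  unfolding linearized_def
  by (intro degree_sum_le)
    (use q_ge_2 in \<open>auto intro!: order.trans[OF degree_monom_le] power_increasing\<close>)

lemma degree_linearized:
  assumes "u \<noteq> 0"
  shows "degree (linearized u) = q ^ degree u"
  using assms by (intro antisym degree_linearized_le le_degree) (simp add: coeff_linearized)

lemma of_nat_q_ac: "of_nat q = (0 :: 'k alg_closure)"
proof -
  \<comment> \<open>Translation by 1 permutes F_q; comparing the sum of all elements with its
    translate leaves q times 1, which is therefore 0.\<close>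
  have "(\<Sum>x\<in>UNIV. x) = (\<Sum>x\<in>UNIV. x + (1 :: 'f))"
    by (rule sum.reindex_bij_witness[of _ "\<lambda>x. x + 1" "\<lambda>x. x - 1"]) auto
  hence "of_nat q = (0 :: 'f)" by (simp add: sum.distrib q_eq)
  hence "to_ac (\<iota> (of_nat q)) = 0" by (simp only: \<iota>.hom_zero to_ac_0)
  thus ?thesis by (simp only: \<iota>.hom_of_nat to_ac_of_nat)
qed

text \<open>For i > 0 the derivative of X^(q^i) carries the factor q^i, which is zero in this
  characteristic. Only the linear term survives.\<close>

lemma pderiv_linearized: "pderiv (linearized u) = [:to_ac (coeff u 0):]"
proof -
  have "pderiv (linearized u) = (\<Sum>i\<le>degree u. if i = 0 then [:to_ac (coeff u 0):] else 0)"
    unfolding linearized_def higher_pderiv_sum[where n = 1, simplified]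
    by (intro sum.cong) (auto simp: pderiv_monom monom_0 of_nat_q_ac zero_power)
  thus ?thesis by simp
qed

text \<open>The derivative of the linearized polynomial of \<open>\<phi> a\<close> is the constant
  \<open>\<iota> (coeff a 0)\<close>, embedded in the closure. That it is nonzero is the form in
  which the exclusion of T is used.\<close>

lemma card_torsion:
  assumes "coeff a 0 \<noteq> 0"
  shows "card (torsion q \<iota> r a) = q ^ (r * degree a)"
proof -
  have 0: "coeff (\<phi> a) 0 \<noteq> 0" using assms coeff_drinfeld[of a 0] by simp
  hence "\<phi> a \<noteq> 0" by auto
  moreover from this have "linearized (\<phi> a) \<noteq> 0"
    using coeff_linearized[of "\<phi> a" "degree (\<phi> a)"] by auto
  ultimately have "card {x. poly (linearized (\<phi> a)) x = 0} = q ^ degree (\<phi> a)"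
    using 0 by (subst card_roots_pderiv_coprime) (simp_all add: pderiv_linearized degree_linearized)
  thus ?thesis by (simp add: torsion_def poly_linearized degree_drinfeld)
qed

lemma skew_act_torsion_eq_0_iff:
  assumes "coeff a 0 \<noteq> 0"
  shows "(\<forall>x\<in>torsion q \<iota> r a. skew_act q u x = 0) \<longleftrightarrow> \<phi> a dvd u"
proof
  assume "\<phi> a dvd u"
  then obtain b where "u = b \<star> \<phi> a" by (auto simp: skew_mult_drinfeld dvd_def mult.commute)
  thus "\<forall>x\<in>torsion q \<iota> r a. skew_act q u x = 0" by (simp add: skew_act_mult torsion_def)
next
  assume *: "\<forall>x\<in>torsion q \<iota> r a. skew_act q u x = 0"
  have a: "\<phi> a \<noteq> 0" using assms by (auto simp: drinfeld_eq_0_iff)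
  \<comment> \<open>The commutative remainder is also a remainder for right skew division by
    \<open>\<phi> a\<close>, and it acts on the torsion as \<open>u\<close> does.\<close>
  let ?h = "u mod \<phi> a"
  have "u = (u div \<phi> a) \<star> \<phi> a + ?h" by (simp add: skew_mult_drinfeld)
  hence "skew_act q u x = skew_act q ?h x" if "x \<in> torsion q \<iota> r a" for x
    using that by (metis (mono_tags, lifting) add_0 mem_Collect_eq skew_act_0(2) skew_act_add_left skew_act_mult torsion_def)
  hence sub: "torsion q \<iota> r a \<subseteq> {x. poly (linearized ?h) x = 0}"
    using * by (auto simp: poly_linearized)
  have "?h = 0"
  proof (rule ccontr)
    assume h: "?h \<noteq> 0"
    hence l: "linearized ?h \<noteq> 0"
      using coeff_linearized[of ?h "degree ?h"] by auto
    have "degree ?h < r * degree a"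
      using degree_mod_less[OF a, of u] h by (simp add: degree_drinfeld)
    \<comment> \<open>Linearization turns the degree in \<tau> into an exponent of q: the degree is
      \<open>q ^ degree ?h\<close>, against \<open>q ^ (r * degree a)\<close> torsion
      points.\<close>
    hence "degree (linearized ?h) < card (torsion q \<iota> r a)"
      using q_ge_2 h assms by (simp add: degree_linearized card_torsion)
    also have "\<dots> \<le> card {x. poly (linearized ?h) x = 0}"
      by (intro card_mono sub poly_roots_finite l)
    also have "\<dots> \<le> degree (linearized ?h)" by (rule card_poly_roots_bound[OF l])
    finally show False by simp
  qed
  thus "\<phi> a dvd u" by auto
qed

end

section \<open>Linear algebra over a field given by a carrier\<close>

text \<open>Linear combinations put coordinate functions in bijection with vectors. Both the length
  of a torsion basis and the dimension of a code are obtained from this count.\<close>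

lemma (in vectorspace) card_carrier_basis:
  assumes "finite A" "basis A"
  shows "card (carrier V) = card (carrier K) ^ card A"
proof -
  have A: "A \<subseteq> carrier V" using assms(2) by (simp add: basis_def)
  have "bij_betw (\<lambda>c. lincomb c A) (A \<rightarrow>\<^sub>E carrier K) (carrier V)"
  proof (rule bij_betw_imageI)
    have uni: "\<exists>!a. a \<in> A \<rightarrow>\<^sub>E carrier K \<and> lincomb a A = v" if "v \<in> carrier V" for v
      using basis_criterion[OF assms(1) A] assms(2) that by blast
    have closed: "lincomb c A \<in> carrier V" if "c \<in> A \<rightarrow>\<^sub>E carrier K" for c
      using that A by (intro lincomb_closed) auto
    show "inj_on (\<lambda>c. lincomb c A) (A \<rightarrow>\<^sub>E carrier K)"
      by (rule inj_onI) (metis closed uni)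
    show "(\<lambda>c. lincomb c A) ` (A \<rightarrow>\<^sub>E carrier K) = carrier V"
      using closed uni by (auto simp: image_iff) metis
  qed
  thus ?thesis using bij_betw_same_card card_funcsetE[OF assms(1)] by metis
qed

lemma (in module) module_hom_zero:
  assumes "f \<in> module_hom R M M"
  shows "f \<zero>\<^bsub>M\<^esub> = \<zero>\<^bsub>M\<^esub>"
proof -
  interpret mod_hom R M M f by unfold_locales (rule assms)
  show ?thesis by simp
qed

lemma (in module) module_hom_finsum:
  assumes "f \<in> module_hom R M M" "finite I" "a \<in> I \<rightarrow> carrier R" "v \<in> I \<rightarrow> carrier M"
  shows "f (\<Oplus>\<^bsub>M\<^esub>k\<in>I. a k \<odot>\<^bsub>M\<^esub> v k) = (\<Oplus>\<^bsub>M\<^esub>k\<in>I. a k \<odot>\<^bsub>M\<^esub> f (v k))"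
  using assms(2-4)
proof (induction I rule: finite_induct)
  case (insert k I)
  have f: "f x \<in> carrier M" if "x \<in> carrier M" for x
    using module_hom_closed[OF assms(1)] that by auto
  have c: "(\<lambda>k. a k \<odot>\<^bsub>M\<^esub> v k) \<in> I \<rightarrow> carrier M" "(\<lambda>k. a k \<odot>\<^bsub>M\<^esub> f (v k)) \<in> I \<rightarrow> carrier M"
    using insert.prems f by auto
  hence "(\<Oplus>\<^bsub>M\<^esub>k\<in>I. a k \<odot>\<^bsub>M\<^esub> v k) \<in> carrier M" by (intro M.finsum_closed)
  thus ?case
    using insert c f by (simp add: module_hom_add[OF assms(1)] module_hom_smult[OF assms(1)] Pi_iff)
qed (simp add: module_hom_zero[OF assms(1)])

text \<open>Members of the carrier are extensional on the module, so equality is tested pointwise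
  there and every ring law reduces to linearity and a law of the module. A \<open>ring_iso\<close>
  does not itself assert that its codomain is a ring; this does so for
  \<open>End_ring\<close>.\<close>

lemma (in module) ring_End_ring: "ring (End_ring R M)"
proof -
  let ?E = "End_ring R M"
  have hom: "x \<in> carrier M \<Longrightarrow> f x \<in> carrier M"
      "x \<in> carrier M \<Longrightarrow> y \<in> carrier M \<Longrightarrow> f (x \<oplus>\<^bsub>M\<^esub> y) = f x \<oplus>\<^bsub>M\<^esub> f y"
      "c \<in> carrier R \<Longrightarrow> x \<in> carrier M \<Longrightarrow> f (c \<odot>\<^bsub>M\<^esub> x) = c \<odot>\<^bsub>M\<^esub> f x"
    if "f \<in> carrier ?E" for f x y c
    using that by (auto simp: End_ring_def module_hom_def)
  have ext: "f = g" if "f \<in> carrier ?E" "g \<in> carrier ?E" "\<And>x. x \<in> carrier M \<Longrightarrow> f x = g x" for f g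
    using that by (auto simp: End_ring_def intro: extensionalityI)
  have mem: "restrict f (carrier M) \<in> carrier ?E"
    if "\<And>x. x \<in> carrier M \<Longrightarrow> f x \<in> carrier M"
      "\<And>x y. x \<in> carrier M \<Longrightarrow> y \<in> carrier M \<Longrightarrow> f (x \<oplus>\<^bsub>M\<^esub> y) = f x \<oplus>\<^bsub>M\<^esub> f y"
      "\<And>c x. c \<in> carrier R \<Longrightarrow> x \<in> carrier M \<Longrightarrow> f (c \<odot>\<^bsub>M\<^esub> x) = c \<odot>\<^bsub>M\<^esub> f x" for f
    using that by (auto simp: End_ring_def module_hom_def)
  have add: "f \<oplus>\<^bsub>?E\<^esub> g = (\<lambda>x\<in>carrier M. f x \<oplus>\<^bsub>M\<^esub> g x)" for f g by (simp add: End_ring_def)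
  have mult: "f \<otimes>\<^bsub>?E\<^esub> g = (\<lambda>x\<in>carrier M. f (g x))" for f g by (simp add: End_ring_def compose_def)
  have one: "\<one>\<^bsub>?E\<^esub> = (\<lambda>x\<in>carrier M. x)" by (simp add: End_ring_def)
  have zero: "\<zero>\<^bsub>?E\<^esub> = (\<lambda>x\<in>carrier M. \<zero>\<^bsub>M\<^esub>)" by (simp add: End_ring_def)
  have add_mem: "f \<oplus>\<^bsub>?E\<^esub> g \<in> carrier ?E" if "f \<in> carrier ?E" "g \<in> carrier ?E" for f g
    unfolding add by (rule mem) (use that in \<open>auto simp: hom M.a_ac smult_r_distr\<close>)
  have mult_mem: "f \<otimes>\<^bsub>?E\<^esub> g \<in> carrier ?E" if "f \<in> carrier ?E" "g \<in> carrier ?E" for f g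
    unfolding mult by (rule mem) (use that in \<open>auto simp: hom\<close>)
  have one_mem: "\<one>\<^bsub>?E\<^esub> \<in> carrier ?E" unfolding one by (rule mem) auto
  have zero_mem: "\<zero>\<^bsub>?E\<^esub> \<in> carrier ?E" unfolding zero by (rule mem) auto
  have app: "(f \<oplus>\<^bsub>?E\<^esub> g) x = f x \<oplus>\<^bsub>M\<^esub> g x" "(f \<otimes>\<^bsub>?E\<^esub> g) x = f (g x)"
      "\<one>\<^bsub>?E\<^esub> x = x" "\<zero>\<^bsub>?E\<^esub> x = \<zero>\<^bsub>M\<^esub>"
    if "x \<in> carrier M" for f g x
    using that by (simp_all add: add mult one zero)
  note ops_mem = add_mem mult_mem one_mem zero_mem
  show ?thesis
  proof (rule ringI)
    show "abelian_group ?E"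
    proof (rule abelian_groupI)
      fix f assume f: "f \<in> carrier ?E"
      let ?g = "\<lambda>x\<in>carrier M. \<ominus>\<^bsub>M\<^esub> f x"
      have g: "?g \<in> carrier ?E"
        by (rule mem) (use f in \<open>auto simp: hom M.minus_add smult_r_minus\<close>)
      moreover have "?g \<oplus>\<^bsub>?E\<^esub> f = \<zero>\<^bsub>?E\<^esub>"
        by (rule ext) (use f g in \<open>simp_all add: ops_mem app hom M.l_neg\<close>)
      ultimately show "\<exists>g\<in>carrier ?E. g \<oplus>\<^bsub>?E\<^esub> f = \<zero>\<^bsub>?E\<^esub>" by blast
    qed (rule ext; simp add: ops_mem app hom M.a_ac | simp add: ops_mem)+
    show "Group.monoid ?E"
      by (rule monoidI; (rule ext)?; simp add: ops_mem app hom)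
  qed (rule ext; simp add: ops_mem app hom)+
qed

section \<open>Coordinates and matrices with respect to an ordered basis\<close>

context vectorspace
begin

lemma coordinates_props:
  assumes "basis (set bs)" "v \<in> carrier V"
  shows "coordinates K V bs v \<in> set bs \<rightarrow>\<^sub>E carrier K"
    and "lincomb (coordinates K V bs v) (set bs) = v"
proof -
  have "set bs \<subseteq> carrier V" using assms(1) by (simp add: basis_def)
  hence "\<exists>!c. c \<in> set bs \<rightarrow>\<^sub>E carrier K \<and> lincomb c (set bs) = v"
    using basis_criterion[of "set bs"] assms by blast
  from theI'[OF this] show "coordinates K V bs v \<in> set bs \<rightarrow>\<^sub>E carrier K"
    and "lincomb (coordinates K V bs v) (set bs) = v"
    by (simp_all add: coordinates_def)
qed

lemma coordinates_unique:
  assumes "basis (set bs)" "c \<in> set bs \<rightarrow> carrier K" "lincomb c (set bs) = v" "b \<in> set bs"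
  shows "coordinates K V bs v b = c b"
proof -
  have sub: "set bs \<subseteq> carrier V" using assms(1) by (simp add: basis_def)
  \<comment> \<open>\<open>coordinates\<close> chooses among functions that are extensional on the
    basis, so an arbitrary coefficient function is cut down to it first.\<close>
  let ?c = "restrict c (set bs)"
  have l: "lincomb ?c (set bs) = v"
    unfolding assms(3)[symmetric]
    by (rule lincomb_cong) (use assms(2) sub in auto)
  have v: "v \<in> carrier V"
    unfolding assms(3)[symmetric] by (rule lincomb_closed[OF sub assms(2)])
  have "\<exists>!c. c \<in> set bs \<rightarrow>\<^sub>E carrier K \<and> lincomb c (set bs) = v"
    using basis_criterion[OF finite_set sub] assms(1) v by simp
  hence "coordinates K V bs v = ?c"
    unfolding coordinates_def using l assms(2) by (intro the1_equality conjI) auto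
  thus ?thesis using assms(4) by simp
qed

lemma coordinates_closed:
  assumes "basis (set bs)" "v \<in> carrier V" "b \<in> set bs"
  shows "coordinates K V bs v b \<in> carrier K"
  using coordinates_props(1)[OF assms(1,2)] assms(3) by auto

lemma coordinates_add:
  assumes bs: "basis (set bs)" and v: "v \<in> carrier V" and w: "w \<in> carrier V" and b: "b \<in> set bs"
  shows "coordinates K V bs (v \<oplus>\<^bsub>V\<^esub> w) b = coordinates K V bs v b \<oplus>\<^bsub>K\<^esub> coordinates K V bs w b"
proof (rule coordinates_unique[OF bs _ _ b])
  have sub: "set bs \<subseteq> carrier V" using bs by (simp add: basis_def)
  note cv = coordinates_props[OF bs v] and cw = coordinates_props[OF bs w]
  show "(\<lambda>b. coordinates K V bs v b \<oplus>\<^bsub>K\<^esub> coordinates K V bs w b) \<in> set bs \<rightarrow> carrier K"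
    using cv(1) cw(1) by auto
  show "lincomb (\<lambda>b. coordinates K V bs v b \<oplus>\<^bsub>K\<^esub> coordinates K V bs w b) (set bs) = v \<oplus>\<^bsub>V\<^esub> w"
    using lincomb_sum[OF finite_set sub, of "coordinates K V bs v" "coordinates K V bs w"] cv cw by auto
qed

lemma coordinates_smult:
  assumes bs: "basis (set bs)" and v: "v \<in> carrier V" and c: "c \<in> carrier K" and b: "b \<in> set bs"
  shows "coordinates K V bs (c \<odot>\<^bsub>V\<^esub> v) b = c \<otimes>\<^bsub>K\<^esub> coordinates K V bs v b"
proof (rule coordinates_unique[OF bs _ _ b])
  have sub: "set bs \<subseteq> carrier V" using bs by (simp add: basis_def)
  note cv = coordinates_props[OF bs v]
  show "(\<lambda>b. c \<otimes>\<^bsub>K\<^esub> coordinates K V bs v b) \<in> set bs \<rightarrow> carrier K"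
    using cv(1) c by auto
  show "lincomb (\<lambda>b. c \<otimes>\<^bsub>K\<^esub> coordinates K V bs v b) (set bs) = c \<odot>\<^bsub>V\<^esub> v"
    using lincomb_smult[OF sub _ c, of "coordinates K V bs v"] cv by auto
qed

lemma coordinates_zero:
  assumes "basis (set bs)" "b \<in> set bs"
  shows "coordinates K V bs \<zero>\<^bsub>V\<^esub> b = \<zero>\<^bsub>K\<^esub>"
  using coordinates_smult[OF assms(1) _ _ assms(2), of "\<zero>\<^bsub>V\<^esub>" "\<zero>\<^bsub>K\<^esub>"]
    coordinates_closed[OF assms(1) _ assms(2)] by simp

lemma coordinates_finsum:
  assumes "basis (set bs)" "b \<in> set bs" "finite I" "a \<in> I \<rightarrow> carrier K" "v \<in> I \<rightarrow> carrier V"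
  shows "coordinates K V bs (\<Oplus>\<^bsub>V\<^esub>k\<in>I. a k \<odot>\<^bsub>V\<^esub> v k) b = (\<Oplus>\<^bsub>K\<^esub>k\<in>I. a k \<otimes>\<^bsub>K\<^esub> coordinates K V bs (v k) b)"
  using assms(3-5)
proof (induction I rule: finite_induct)
  case (insert k I)
  have cl: "coordinates K V bs (v k') b \<in> carrier K" if "k' \<in> insert k I" for k'
    by (rule coordinates_closed[OF assms(1) _ assms(2)]) (use insert.prems that in auto)
  have c: "(\<lambda>k. a k \<odot>\<^bsub>V\<^esub> v k) \<in> I \<rightarrow> carrier V"
    "(\<lambda>k. a k \<otimes>\<^bsub>K\<^esub> coordinates K V bs (v k) b) \<in> I \<rightarrow> carrier K"
    using insert.prems coordinates_closed[OF assms(1) _ assms(2)] by auto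
  hence "(\<Oplus>\<^bsub>V\<^esub>k\<in>I. a k \<odot>\<^bsub>V\<^esub> v k) \<in> carrier V" by (intro M.finsum_closed)
  thus ?case
    using insert c cl assms(1,2)
    by (simp add: coordinates_add coordinates_smult coordinates_closed Pi_iff)
qed (use assms in \<open>simp add: coordinates_zero\<close>)

lemma coordinates_basis:
  assumes bs: "basis (set bs)" and b: "b \<in> set bs" and b': "b' \<in> set bs"
  shows "coordinates K V bs b b' = (if b = b' then \<one>\<^bsub>K\<^esub> else \<zero>\<^bsub>K\<^esub>)"
proof (rule coordinates_unique[OF bs _ _ b'])
  have sub: "set bs \<subseteq> carrier V" using bs by (simp add: basis_def)
  have "lincomb (\<lambda>b'. if b = b' then \<one>\<^bsub>K\<^esub> else \<zero>\<^bsub>K\<^esub>) (set bs) = (\<Oplus>\<^bsub>V\<^esub>b'\<in>set bs. if b = b' then b' else \<zero>\<^bsub>V\<^esub>)"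
    unfolding lincomb_def using sub by (intro M.finsum_cong') auto
  also have "\<dots> = b"
    using sub b by (subst M.finsum_singleton[OF b finite_set]) auto
  finally show "lincomb (\<lambda>b'. if b = b' then \<one>\<^bsub>K\<^esub> else \<zero>\<^bsub>K\<^esub>) (set bs) = b" .
qed auto

lemma ring_hom_finsum:
  assumes "\<chi> \<in> Ring.ring_hom K (class_ring :: 'e::ring_1 ring)" "finite I" "a \<in> I \<rightarrow> carrier K"
  shows "\<chi> (\<Oplus>\<^bsub>K\<^esub>k\<in>I. a k) = (\<Sum>k\<in>I. \<chi> (a k))"
proof -
  interpret h: ring_hom_ring K "class_ring :: 'e ring" \<chi>
    by (intro ring_hom_ringI2) (use assms(1) in \<open>auto intro: R.ring_axioms class_ring.ring_axioms\<close>)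
  show ?thesis using assms(2,3)
  proof (induction I rule: finite_induct)
    case (insert k I)
    thus ?case using h.hom_add by (simp add: Pi_iff)
  qed (use h.hom_zero in simp)
qed

lemma endo_eq_finsum:
  assumes bs: "basis (set bs)" and f: "f \<in> carrier (End_ring K V)" and v: "v \<in> carrier V"
  shows "f v = (\<Oplus>\<^bsub>V\<^esub>b\<in>set bs. coordinates K V bs v b \<odot>\<^bsub>V\<^esub> f b)"
proof -
  have sub: "set bs \<subseteq> carrier V" using bs by (simp add: basis_def)
  have "f v = f (\<Oplus>\<^bsub>V\<^esub>b\<in>set bs. coordinates K V bs v b \<odot>\<^bsub>V\<^esub> b)"
    using coordinates_props(2)[OF bs v] by (simp add: lincomb_def)
  also have "\<dots> = (\<Oplus>\<^bsub>V\<^esub>b\<in>set bs. coordinates K V bs v b \<odot>\<^bsub>V\<^esub> f b)"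
    using f sub coordinates_closed[OF bs v] by (intro module_hom_finsum) (auto simp: End_ring_def)
  finally show ?thesis .
qed

text \<open>Injectivity of \<open>\<chi>\<close> recovers the coordinates from the entries, so equal
  matrices mean equal images of the basis vectors, and these determine an endomorphism.\<close>

lemma matrix_of_endo_inj:
  assumes "inj_on \<chi> (carrier K)" and bs: "basis (set bs)"
  shows "inj_on (matrix_of_endo K V \<chi> bs) (carrier (End_ring K V))"
proof (rule inj_onI)
  fix f g assume f: "f \<in> carrier (End_ring K V)" and g: "g \<in> carrier (End_ring K V)"
    and eq: "matrix_of_endo K V \<chi> bs f = matrix_of_endo K V \<chi> bs g"
  have sub: "set bs \<subseteq> carrier V" using bs by (simp add: basis_def)
  have cl: "h b \<in> carrier V" if "h \<in> carrier (End_ring K V)" "b \<in> set bs" for h b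
    using that sub by (auto simp: End_ring_def module_hom_def)
  have "f b = g b" if "b \<in> set bs" for b
  proof -
    obtain j where j: "j < length bs" "b = bs ! j" using \<open>b \<in> set bs\<close> by (metis in_set_conv_nth)
    have "coordinates K V bs (f b) b' = coordinates K V bs (g b) b'" if b': "b' \<in> set bs" for b'
    proof -
      obtain i where i: "i < length bs" "b' = bs ! i" using b' by (metis in_set_conv_nth)
      have "matrix_of_endo K V \<chi> bs f $$ (i, j) = matrix_of_endo K V \<chi> bs g $$ (i, j)" using eq by simp
      hence "\<chi> (coordinates K V bs (f b) b') = \<chi> (coordinates K V bs (g b) b')"
        using i j by (simp add: matrix_of_endo_def)
      thus ?thesis
        using assms(1) coordinates_closed[OF bs cl b'] f g \<open>b \<in> set bs\<close> by (auto dest: inj_onD)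
    qed
    moreover have "coordinates K V bs (f b) \<in> extensional (set bs)" "coordinates K V bs (g b) \<in> extensional (set bs)"
      using coordinates_props(1)[OF bs cl] f g that by (auto simp: PiE_def)
    ultimately have "coordinates K V bs (f b) = coordinates K V bs (g b)" by (intro extensionalityI)
    thus ?thesis using coordinates_props(2)[OF bs cl] f g that by metis
  qed
  hence "f v = g v" if "v \<in> carrier V" for v
    using endo_eq_finsum[OF bs f that] endo_eq_finsum[OF bs g that] cl[OF g] coordinates_closed[OF bs that]
    by (auto intro!: M.finsum_cong')
  thus "f = g" using f g by (auto simp: End_ring_def intro: extensionalityI)
qed

lemma matrix_of_endo_hom:
  fixes \<chi> :: "'a \<Rightarrow> 'e::comm_ring_1"
  assumes \<chi>: "\<chi> \<in> Ring.ring_hom K class_ring" and dist: "distinct bs" and bs: "basis (set bs)"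
  shows "matrix_of_endo K V \<chi> bs \<in> Ring.ring_hom (End_ring K V) (ring_mat TYPE('e) (length bs) ())"
proof (rule ring_hom_memI)
  let ?M = "matrix_of_endo K V \<chi> bs" and ?R = "ring_mat TYPE('e) (length bs) ()"
  have sub: "set bs \<subseteq> carrier V" using bs by (simp add: basis_def)
  have cl: "h v \<in> carrier V" if "h \<in> carrier (End_ring K V)" "v \<in> carrier V" for h v
    using that by (auto simp: End_ring_def module_hom_def)
  have nth: "bs ! i \<in> set bs" "bs ! i \<in> carrier V" if "i < length bs" for i
    using that sub by auto
  show "?M f \<in> carrier ?R" for f
    by (simp add: ring_mat_simps matrix_of_endo_def)
  fix f g assume f: "f \<in> carrier (End_ring K V)" and g: "g \<in> carrier (End_ring K V)"
  show "?M (f \<oplus>\<^bsub>End_ring K V\<^esub> g) = ?M f \<oplus>\<^bsub>?R\<^esub> ?M g"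
    using f g ring_hom_add[OF \<chi>]
    by (auto intro!: eq_matI simp: ring_mat_simps matrix_of_endo_def End_ring_def nth
        coordinates_add[OF bs] cl coordinates_closed[OF bs])
  show "?M (f \<otimes>\<^bsub>End_ring K V\<^esub> g) = ?M f \<otimes>\<^bsub>?R\<^esub> ?M g"
  proof (rule eq_matI)
    fix i j assume "i < dim_row (?M f \<otimes>\<^bsub>?R\<^esub> ?M g)" "j < dim_col (?M f \<otimes>\<^bsub>?R\<^esub> ?M g)"
    hence i: "i < length bs" and j: "j < length bs"
      by (simp_all add: ring_mat_simps matrix_of_endo_def)
    \<comment> \<open>The coordinates of \<open>v\<close> form column \<open>j\<close> of the matrix
      of \<open>g\<close>; expanding \<open>f v\<close> along them produces the matrix
      product.\<close>
    define v where "v = g (bs ! j)"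
    have v: "v \<in> carrier V" unfolding v_def by (rule cl[OF g nth(2)[OF j]])
    have fb: "f b \<in> carrier V" if "b \<in> set bs" for b using cl[OF f] that sub by auto
    have "(?M (f \<otimes>\<^bsub>End_ring K V\<^esub> g)) $$ (i, j) = \<chi> (coordinates K V bs (f v) (bs ! i))"
      using i j nth by (simp add: matrix_of_endo_def End_ring_def compose_def v_def)
    also have "\<dots> = \<chi> (\<Oplus>\<^bsub>K\<^esub>b\<in>set bs. coordinates K V bs v b \<otimes>\<^bsub>K\<^esub> coordinates K V bs (f b) (bs ! i))"
      using coordinates_closed[OF bs v] fb i
      by (subst endo_eq_finsum[OF bs f v], subst coordinates_finsum[OF bs]) auto
    \<comment> \<open>The expansion lists the coordinate of \<open>v\<close> first, while the matrix
      product has the entry of \<open>f\<close> on the left; commutativity of the scalars swaps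
      them.\<close>
    also have "\<dots> = (\<Sum>b\<in>set bs. \<chi> (coordinates K V bs (f b) (bs ! i)) * \<chi> (coordinates K V bs v b))"
      using coordinates_closed[OF bs v] coordinates_closed[OF bs fb] i ring_hom_mult[OF \<chi>]
      by (subst ring_hom_finsum[OF \<chi>]) (auto simp: mult.commute)
    \<comment> \<open>Passing from basis vectors to their positions needs the list to be
      distinct.\<close>
    also have "\<dots> = (\<Sum>k<length bs. \<chi> (coordinates K V bs (f (bs ! k)) (bs ! i)) * \<chi> (coordinates K V bs v (bs ! k)))"
      by (rule sum.reindex_bij_betw[OF bij_betw_nth[OF dist refl refl], symmetric])
    also have "\<dots> = (?M f \<otimes>\<^bsub>?R\<^esub> ?M g) $$ (i, j)"
      using i j by (simp add: ring_mat_simps matrix_of_endo_def scalar_prod_def v_def lessThan_atLeast0)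
    finally show "(?M (f \<otimes>\<^bsub>End_ring K V\<^esub> g)) $$ (i, j) = (?M f \<otimes>\<^bsub>?R\<^esub> ?M g) $$ (i, j)" .
  qed (simp_all add: ring_mat_simps matrix_of_endo_def)
next
  interpret h: ring_hom_ring K "class_ring :: 'e ring" \<chi>
    by (intro ring_hom_ringI2) (use \<chi> in \<open>auto intro: R.ring_axioms class_ring.ring_axioms\<close>)
  have "bs ! j \<in> carrier V" if "j < length bs" for j using that bs by (auto simp: basis_def)
  thus "matrix_of_endo K V \<chi> bs \<one>\<^bsub>End_ring K V\<^esub> = \<one>\<^bsub>ring_mat TYPE('e) (length bs) ()\<^esub>"
    using h.hom_one h.hom_zero dist
    by (auto intro!: eq_matI
        simp: ring_mat_simps matrix_of_endo_def End_ring_def coordinates_basis[OF bs] nth_eq_iff_index_eq)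
qed

end

section \<open>Products of rings indexed by lists\<close>

lemma RDirProd_list_Cons_ops:
  assumes "a \<in> carrier R" "as \<in> carrier (RDirProd_list Rs)" "b \<in> carrier R" "bs \<in> carrier (RDirProd_list Rs)"
  shows "(a # as) \<otimes>\<^bsub>RDirProd_list (R # Rs)\<^esub> (b # bs) = (a \<otimes>\<^bsub>R\<^esub> b) # (as \<otimes>\<^bsub>RDirProd_list Rs\<^esub> bs)"
    and "(a # as) \<oplus>\<^bsub>RDirProd_list (R # Rs)\<^esub> (b # bs) = (a \<oplus>\<^bsub>R\<^esub> b) # (as \<oplus>\<^bsub>RDirProd_list Rs\<^esub> bs)"
  using ring_hom_mult[OF RDirProd_list_hom1, of "(a, as)" R Rs "(b, bs)"]
    ring_hom_add[OF RDirProd_list_hom1, of "(a, as)" R Rs "(b, bs)"] assms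
  by (simp_all add: RDirProd_def DirProd_def monoid.defs)

lemma RDirProd_list_one_map: "\<one>\<^bsub>RDirProd_list Rs\<^esub> = map one Rs"
  unfolding RDirProd_list_one by (induction Rs) simp_all

text \<open>The product ring is built recursively from pairs. Maps into and between products are
  given by index below, so the operations are brought into indexed form, valid on carrier
  elements.\<close>

lemma RDirProd_list_ops:
  assumes "as \<in> carrier (RDirProd_list Rs)" "bs \<in> carrier (RDirProd_list Rs)"
  shows "as \<otimes>\<^bsub>RDirProd_list Rs\<^esub> bs = map (\<lambda>i. as ! i \<otimes>\<^bsub>Rs ! i\<^esub> bs ! i) [0..<length Rs]" (is ?mult)
    and "as \<oplus>\<^bsub>RDirProd_list Rs\<^esub> bs = map (\<lambda>i. as ! i \<oplus>\<^bsub>Rs ! i\<^esub> bs ! i) [0..<length Rs]" (is ?add)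
proof -
  have "?mult \<and> ?add"
    using assms
  proof (induction Rs arbitrary: as bs)
    case Nil
    thus ?case by (simp add: monoid.defs)
  next
    case (Cons R Rs)
    then obtain a as' b bs' where
      "as = a # as'" "a \<in> carrier R" "as' \<in> carrier (RDirProd_list Rs)"
      "bs = b # bs'" "b \<in> carrier R" "bs' \<in> carrier (RDirProd_list Rs)"
      unfolding RDirProd_list_carrier by auto
    thus ?case
      using Cons.IH[of as' bs']
      by (simp add: RDirProd_list_Cons_ops upt_conv_Cons map_Suc_upt[symmetric] comp_def del: upt_Suc)
  qed
  thus ?mult ?add by simp_all
qed

lemma ring_hom_RDirProd_list:
  assumes "length Ss = n" "\<And>i. i < n \<Longrightarrow> f i \<in> Ring.ring_hom R (Ss ! i)"
  shows "(\<lambda>x. map (\<lambda>i. f i x) [0..<n]) \<in> Ring.ring_hom R (RDirProd_list Ss)"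
proof -
  have c: "map (\<lambda>i. f i x) [0..<n] \<in> carrier (RDirProd_list Ss)" if "x \<in> carrier R" for x
    using assms ring_hom_closed[OF assms(2) that] by (intro RDirProd_list_carrier_memI) auto
  show ?thesis
    by (rule ring_hom_memI)
      (use assms in \<open>auto simp: c RDirProd_list_ops RDirProd_list_one_map ring_hom_mult ring_hom_add
        ring_hom_one intro!: nth_equalityI\<close>)
qed

lemma ring_iso_RDirProd_list:
  assumes "length Rs = n" "length Ss = n" "\<And>i. i < n \<Longrightarrow> f i \<in> ring_iso (Rs ! i) (Ss ! i)"
  shows "(\<lambda>xs. map (\<lambda>i. f i (xs ! i)) [0..<n]) \<in> ring_iso (RDirProd_list Rs) (RDirProd_list Ss)"
    (is "?F \<in> _")
proof -
  have hom: "f i \<in> Ring.ring_hom (Rs ! i) (Ss ! i)" and bij: "bij_betw (f i) (carrier (Rs ! i)) (carrier (Ss ! i))"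
    if "i < n" for i using assms(3)[OF that] by (simp_all add: ring_iso_def)
  have mem: "xs ! i \<in> carrier (Rs ! i)" if "xs \<in> carrier (RDirProd_list Rs)" "i < n" for xs i
    using RDirProd_list_carrier_mem(2)[OF that(1)] that(2) assms(1) by simp
  have c: "?F xs \<in> carrier (RDirProd_list Ss)" if "xs \<in> carrier (RDirProd_list Rs)" for xs
    using assms(2) ring_hom_closed[OF hom mem[OF that]] by (intro RDirProd_list_carrier_memI) auto
  show ?thesis
  proof (rule ring_iso_memI)
    fix xs ys assume xs: "xs \<in> carrier (RDirProd_list Rs)" and ys: "ys \<in> carrier (RDirProd_list Rs)"
    show "?F xs \<in> carrier (RDirProd_list Ss)" by (rule c[OF xs])
    show "?F (xs \<otimes>\<^bsub>RDirProd_list Rs\<^esub> ys) = ?F xs \<otimes>\<^bsub>RDirProd_list Ss\<^esub> ?F ys"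
      using assms(1,2) mem[OF xs] mem[OF ys]
      by (simp add: RDirProd_list_ops[OF xs ys] RDirProd_list_ops[OF c c] xs ys ring_hom_mult[OF hom])
    show "?F (xs \<oplus>\<^bsub>RDirProd_list Rs\<^esub> ys) = ?F xs \<oplus>\<^bsub>RDirProd_list Ss\<^esub> ?F ys"
      using assms(1,2) mem[OF xs] mem[OF ys]
      by (simp add: RDirProd_list_ops[OF xs ys] RDirProd_list_ops[OF c c] xs ys ring_hom_add[OF hom])
  next
    show "?F \<one>\<^bsub>RDirProd_list Rs\<^esub> = \<one>\<^bsub>RDirProd_list Ss\<^esub>"
      using assms(1,2) ring_hom_one[OF hom] by (auto simp: RDirProd_list_one_map intro!: nth_equalityI)
  next
    show "bij_betw ?F (carrier (RDirProd_list Rs)) (carrier (RDirProd_list Ss))"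
    proof (rule bij_betw_byWitness[where f' = "\<lambda>ys. map (\<lambda>i. inv_into (carrier (Rs ! i)) (f i) (ys ! i)) [0..<n]"])
      show "\<forall>xs\<in>carrier (RDirProd_list Rs). map (\<lambda>i. inv_into (carrier (Rs ! i)) (f i) (?F xs ! i)) [0..<n] = xs"
        using assms(1) bij_betw_inv_into_left[OF bij mem]
        by (auto intro!: nth_equalityI simp: RDirProd_list_carrier_mem(1))
      have mem': "ys ! i \<in> carrier (Ss ! i)" if "ys \<in> carrier (RDirProd_list Ss)" "i < n" for ys i
        using RDirProd_list_carrier_mem(2)[OF that(1)] that(2) assms(2) by simp
      show "\<forall>ys\<in>carrier (RDirProd_list Ss). ?F (map (\<lambda>i. inv_into (carrier (Rs ! i)) (f i) (ys ! i)) [0..<n]) = ys"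
        using assms(2) bij_betw_inv_into_right[OF bij mem']
        by (auto intro!: nth_equalityI simp: RDirProd_list_carrier_mem(1))
      show "?F ` carrier (RDirProd_list Rs) \<subseteq> carrier (RDirProd_list Ss)" using c by auto
      show "(\<lambda>ys. map (\<lambda>i. inv_into (carrier (Rs ! i)) (f i) (ys ! i)) [0..<n]) ` carrier (RDirProd_list Ss)
          \<subseteq> carrier (RDirProd_list Rs)"
        using assms(1) mem' bij
        by (auto intro!: RDirProd_list_carrier_memI bij_betwE[OF bij_betw_inv_into, THEN bspec])
    qed
  qed
qed

section \<open>Quotients and the torsion module\<close>

text \<open>The identification of A/(q_i) with a finite field is part of the data; pulling the field
  structure back along it shows that A/(q_i) is a field.\<close>

lemma field_of_ring_iso:
  fixes S :: "('b, 'c) ring_scheme"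
  assumes "h \<in> ring_iso R S" "ring R" "field S"
  shows "field R"
proof -
  interpret S: field S by fact
  have inv: "inv_into (carrier R) h \<in> ring_iso S R" by (rule ring_iso_set_sym[OF assms(2,1)])
  \<comment> \<open>Transport yields a field whose zero is the image of the zero of
    \<open>S\<close>; that element has to be recognized as the zero of \<open>R\<close>.\<close>
  have "inv_into (carrier R) h \<zero>\<^bsub>S\<^esub> = \<zero>\<^bsub>R\<^esub>"
    by (rule ring_hom_zero) (use inv assms S.ring_axioms in \<open>auto simp: ring_iso_def\<close>)
  with S.ring_iso_imp_img_field[OF inv] show ?thesis by simp
qed

lemma card_carrier_mat: "card (carrier_mat n m :: 'e::finite mat set) = CARD('e) ^ (n * m)"
proof -
  let ?I = "{..<n} \<times> {..<m}"
  have "bij_betw (mat n m) (?I \<rightarrow>\<^sub>E UNIV) (carrier_mat n m :: 'e mat set)"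
  proof (rule bij_betw_byWitness[where f' = "\<lambda>M. \<lambda>ij\<in>?I. M $$ ij"])
    show "\<forall>f\<in>?I \<rightarrow>\<^sub>E UNIV. (\<lambda>ij\<in>?I. mat n m f $$ ij) = f"
      by (auto simp: fun_eq_iff PiE_def extensional_def)
    show "\<forall>M\<in>carrier_mat n m. mat n m (\<lambda>ij\<in>?I. M $$ ij) = M"
      by (auto intro!: eq_matI)
  qed (auto split: if_splits)
  hence "card (carrier_mat n m :: 'e mat set) = card (?I \<rightarrow>\<^sub>E (UNIV :: 'e set))"
    by (rule bij_betw_same_card[symmetric])
  thus ?thesis by (simp add: card_funcsetE)
qed

text \<open>Such a polynomial is its vector of \<open>n\<close> coefficients. The clause
  \<open>u = 0\<close> keeps the count right for \<open>n = 0\<close>.\<close>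

lemma card_degree_less: "card {u :: 'a::{finite,comm_monoid_add} poly. u = 0 \<or> degree u < n} = CARD('a) ^ n"
proof -
  let ?P = "{u :: 'a poly. u = 0 \<or> degree u < n}"
  have "bij_betw (\<lambda>u. restrict (coeff u) {..<n}) ?P ({..<n} \<rightarrow>\<^sub>E UNIV)"
  proof (rule bij_betw_byWitness[where f' = "\<lambda>c. \<Sum>i<n. monom (c i) i"])
    have deg: "coeff u i = 0" if "u \<in> ?P" "n \<le> i" for u i
      using that by (auto intro: coeff_eq_0)
    show "\<forall>u\<in>?P. (\<Sum>i<n. monom (restrict (coeff u) {..<n} i) i) = u"
      using deg by (auto intro!: poly_eqI simp: coeff_sum not_less)
    show "\<forall>c\<in>{..<n} \<rightarrow>\<^sub>E UNIV. restrict (coeff (\<Sum>i<n. monom (c i) i)) {..<n} = c"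
      by (auto simp: fun_eq_iff coeff_sum PiE_def extensional_def)
    show "(\<lambda>c. \<Sum>i<n. monom (c i) i) ` ({..<n} \<rightarrow>\<^sub>E UNIV) \<subseteq> ?P"
    proof clarify
      fix c :: "nat \<Rightarrow> 'a"
      let ?u = "\<Sum>i<n. monom (c i) i"
      assume "\<not> degree ?u < n"
      hence "lead_coeff ?u = 0" by (simp add: coeff_sum)
      thus "?u = 0" by simp
    qed
  qed (auto split: if_splits)
  from bij_betw_same_card[OF this] show ?thesis by (simp add: card_funcsetE)
qed

lemma PIdl_poly: "PIdl\<^bsub>class_ring\<^esub> a = {v. a dvd v}" for a :: "'a::comm_ring_1"
  by (simp add: cgenideal_def dvd_def mult.commute[of a])

lemma poly_class_eq: "PIdl\<^bsub>class_ring\<^esub> a +>\<^bsub>class_ring\<^esub> b = {v. a dvd v - b}" for a b :: "'a::comm_ring_1"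
proof (rule Set.set_eqI)
  fix v
  have "v \<in> PIdl\<^bsub>class_ring\<^esub> a +>\<^bsub>class_ring\<^esub> b \<longleftrightarrow> (\<exists>h. a dvd h \<and> v = h + b)"
    unfolding PIdl_poly by (auto simp: a_r_coset_def')
  also have "\<dots> \<longleftrightarrow> a dvd v - b" by (metis add_diff_cancel diff_add_cancel)
  finally show "v \<in> PIdl\<^bsub>class_ring\<^esub> a +>\<^bsub>class_ring\<^esub> b \<longleftrightarrow> v \<in> {v. a dvd v - b}" by simp
qed

lemma carrier_poly_quot: "carrier (poly_quot a) = range (\<lambda>b. PIdl\<^bsub>class_ring\<^esub> a +>\<^bsub>class_ring\<^esub> b)"
  by (auto simp: FactRing_def A_RCOSETS_def')

lemma ideal_poly: "ideal (PIdl\<^bsub>class_ring\<^esub> a) class_ring" for a :: "'a::field poly"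
  using class_cring.cring_axioms by (intro cring.cgenideal_ideal) simp_all

lemma poly_class_hom:
  "(\<lambda>b. PIdl\<^bsub>class_ring\<^esub> a +>\<^bsub>class_ring\<^esub> b) \<in> Ring.ring_hom class_ring (poly_quot a)" for a :: "'a::field poly"
  using ideal.rcos_ring_hom[OF ideal_poly] .

section \<open>Residue rings of R modulo the central elements \<open>\<phi> a\<close>\<close>

context finite_drinfeld
begin

lemma PIdl_drinfeld: "PIdl\<^bsub>skew_ring q\<^esub> (\<phi> a) = {v. \<phi> a dvd v}"
  by (simp add: cgenideal_def dvd_def skew_mult_drinfeld mult.commute[of "\<phi> a"])

lemma skew_class_eq: "skew_class q (\<phi> a) u = {v. \<phi> a dvd v - u}"
proof (rule Set.set_eqI)
  fix v
  have "v \<in> skew_class q (\<phi> a) u \<longleftrightarrow> (\<exists>h. \<phi> a dvd h \<and> v = h + u)"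
    unfolding PIdl_drinfeld by (auto simp: a_r_coset_def')
  also have "\<dots> \<longleftrightarrow> \<phi> a dvd v - u" by (metis add_diff_cancel diff_add_cancel)
  finally show "v \<in> skew_class q (\<phi> a) u \<longleftrightarrow> v \<in> {v. \<phi> a dvd v - u}" by simp
qed

lemma skew_class_eq_iff: "skew_class q (\<phi> a) u = skew_class q (\<phi> a) v \<longleftrightarrow> \<phi> a dvd u - v"
proof
  assume "skew_class q (\<phi> a) u = skew_class q (\<phi> a) v"
  hence "u \<in> skew_class q (\<phi> a) v" by (auto simp: skew_class_eq)
  thus "\<phi> a dvd u - v" by (simp add: skew_class_eq)
next
  assume *: "\<phi> a dvd u - v"
  have "\<phi> a dvd w - u \<longleftrightarrow> \<phi> a dvd w - v" for w
    using dvd_add[OF _ *, of "w - u"] dvd_diff[OF _ *, of "w - v"] by auto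
  thus "skew_class q (\<phi> a) u = skew_class q (\<phi> a) v" by (simp add: skew_class_eq)
qed

lemma ideal_drinfeld: "ideal (PIdl\<^bsub>skew_ring q\<^esub> (\<phi> a)) (skew_ring q)"
proof (rule idealI[OF R.ring_axioms])
  have "inv\<^bsub>add_monoid (skew_ring q)\<^esub> v = - v" for v :: "'k poly"
    using R.minus_equality[of "- v" v] by (simp only: a_inv_def) simp
  hence "subgroup {v. \<phi> a dvd v} (add_monoid (skew_ring q))"
    by (intro group.subgroupI[OF R.a_group]) (auto intro!: exI[of _ 0])
  thus "subgroup (PIdl\<^bsub>skew_ring q\<^esub> (\<phi> a)) (add_monoid (skew_ring q))" by (simp add: PIdl_drinfeld)
  fix v x :: "'k poly" assume "v \<in> PIdl\<^bsub>skew_ring q\<^esub> (\<phi> a)"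
  then obtain b where b: "v = b \<star> \<phi> a" by (auto simp: cgenideal_def)
  show "x \<otimes>\<^bsub>skew_ring q\<^esub> v \<in> PIdl\<^bsub>skew_ring q\<^esub> (\<phi> a)"
    unfolding b by (auto simp: cgenideal_def simp flip: skew_mult_assoc)
  \<comment> \<open>Closure under right multiplication is where the left ideal becomes two-sided:
    the central factor moves past \<open>x\<close>.\<close>
  have "v \<star> x = b \<star> x \<star> \<phi> a" unfolding b by (metis drinfeld_central skew_mult_assoc)
  thus "v \<otimes>\<^bsub>skew_ring q\<^esub> x \<in> PIdl\<^bsub>skew_ring q\<^esub> (\<phi> a)" by (auto simp: cgenideal_def)
qed

lemma skew_class_hom: "skew_class q (\<phi> a) \<in> Ring.ring_hom (skew_ring q) (skew_quot q (\<phi> a))"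
  by (rule ideal.rcos_ring_hom[OF ideal_drinfeld])

lemma ring_skew_quot: "ring (skew_quot q (\<phi> a))"
  by (rule ideal.quotient_is_ring[OF ideal_drinfeld])

lemma carrier_skew_quot: "carrier (skew_quot q (\<phi> a)) = range (skew_class q (\<phi> a))"
  by (auto simp: FactRing_def A_RCOSETS_def')

text \<open>The hypothesis on \<open>F\<close> carries the well-definedness, so one lemma serves
  both the restriction to torsion and the Chinese remainder map.\<close>

lemma ring_hom_skew_quot:
  assumes h: "h \<in> Ring.ring_hom (skew_ring q) S" and F: "\<And>u. F (skew_class q (\<phi> a) u) = h u"
  shows "F \<in> Ring.ring_hom (skew_quot q (\<phi> a)) S"
proof (rule ring_hom_memI)
  note c = skew_class_hom[of a]
  fix C D assume "C \<in> carrier (skew_quot q (\<phi> a))" "D \<in> carrier (skew_quot q (\<phi> a))"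
  then obtain u v where uv: "C = skew_class q (\<phi> a) u" "D = skew_class q (\<phi> a) v"
    by (auto simp: carrier_skew_quot)
  show "F C \<in> carrier S"
    using ring_hom_closed[OF h] by (simp add: uv F)
  show "F (C \<otimes>\<^bsub>skew_quot q (\<phi> a)\<^esub> D) = F C \<otimes>\<^bsub>S\<^esub> F D"
    using ring_hom_mult[OF h, of u v] by (simp add: uv F flip: ring_hom_mult[OF c])
  show "F (C \<oplus>\<^bsub>skew_quot q (\<phi> a)\<^esub> D) = F C \<oplus>\<^bsub>S\<^esub> F D"
    using ring_hom_add[OF h, of u v] by (simp add: uv F flip: ring_hom_add[OF c])
next
  show "F \<one>\<^bsub>skew_quot q (\<phi> a)\<^esub> = \<one>\<^bsub>S\<^esub>"
    using ring_hom_one[OF h] by (simp add: F flip: ring_hom_one[OF skew_class_hom[of a]])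
qed

lemma card_skew_quot:
  assumes "a \<noteq> 0"
  shows "card (carrier (skew_quot q (\<phi> a))) = CARD('k) ^ (r * degree a)"
proof -
  have a: "\<phi> a \<noteq> 0" using assms by (simp add: drinfeld_eq_0_iff)
  let ?P = "{u :: 'k poly. u = 0 \<or> degree u < r * degree a}"
  have "bij_betw (skew_class q (\<phi> a)) ?P (carrier (skew_quot q (\<phi> a)))"
  proof (rule bij_betw_imageI)
    show "inj_on (skew_class q (\<phi> a)) ?P"
    proof (rule inj_onI)
      fix u v assume u: "u \<in> ?P" and v: "v \<in> ?P" and "skew_class q (\<phi> a) u = skew_class q (\<phi> a) v"
      hence "\<phi> a dvd u - v" by (simp add: skew_class_eq_iff)
      moreover have "u - v = 0 \<or> degree (u - v) < degree (\<phi> a)"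
        using u v degree_diff_less[of u "r * degree a" v] by (auto simp: degree_drinfeld)
      ultimately have "u - v = 0" by (meson dvd_imp_degree_le not_less)
      thus "u = v" by simp
    qed
    have "skew_class q (\<phi> a) u \<in> skew_class q (\<phi> a) ` ?P" for u
    proof (rule image_eqI)
      have "u - u mod \<phi> a = (u div \<phi> a) * \<phi> a" by (simp add: minus_mod_eq_div_mult)
      thus "skew_class q (\<phi> a) u = skew_class q (\<phi> a) (u mod \<phi> a)" by (simp add: skew_class_eq_iff)
      show "u mod \<phi> a \<in> ?P" using degree_mod_less[OF a, of u] by (simp add: degree_drinfeld)
    qed
    thus "skew_class q (\<phi> a) ` ?P = carrier (skew_quot q (\<phi> a))" by (auto simp: carrier_skew_quot)
  qed
  from bij_betw_same_card[OF this] show ?thesis by (simp add: card_degree_less)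
qed

section \<open>The torsion as a module over A/(a)\<close>

abbreviation torsion_mod where "torsion_mod \<equiv> torsion_module q \<iota> r"

lemma torsion_module_simps [simp]:
  "carrier (torsion_mod a) = torsion q \<iota> r a" "zero (torsion_mod a) = 0" "add (torsion_mod a) = (+)"
  by (simp_all add: torsion_module_def)

lemma skew_act_torsion:
  assumes "x \<in> torsion q \<iota> r a"
  shows "skew_act q u x \<in> torsion q \<iota> r a"
proof -
  have "skew_act q (\<phi> a) (skew_act q u x) = skew_act q u (skew_act q (\<phi> a) x)"
    by (simp add: drinfeld_central flip: skew_act_mult)
  thus ?thesis using assms by (simp add: torsion_def)
qed

lemma skew_act_cong_dvd:
  assumes "\<phi> a dvd u - v" "x \<in> torsion q \<iota> r a"
  shows "skew_act q u x = skew_act q v x"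
proof -
  obtain b where "u - v = b \<star> \<phi> a" using assms(1) by (auto simp: skew_mult_drinfeld dvd_def mult.commute)
  hence "skew_act q (u - v) x = 0" using assms(2) by (simp add: skew_act_mult torsion_def)
  thus ?thesis by (simp add: skew_act_diff)
qed

lemma drinfeld_diff: "\<phi> (b - c) = \<phi> b - \<phi> c"
  using drinfeld_hom(2)[of "b - c" c] by (simp add: algebra_simps)

text \<open>Representatives of one class differ by a multiple of \<open>a\<close>, which acts as
  zero on the a-torsion. So the set inside \<open>the_elem\<close> is a singleton.\<close>

lemma torsion_smult:
  assumes "x \<in> torsion q \<iota> r a"
  shows "(PIdl\<^bsub>class_ring\<^esub> a +>\<^bsub>class_ring\<^esub> b) \<odot>\<^bsub>torsion_mod a\<^esub> x = skew_act q (\<phi> b) x"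
proof -
  have "(\<lambda>c. skew_act q (\<phi> c) x) ` {v. a dvd v - b} = {skew_act q (\<phi> b) x}"
  proof -
    have "skew_act q (\<phi> c) x = skew_act q (\<phi> b) x" if "a dvd c - b" for c
    proof (rule skew_act_cong_dvd[OF _ assms])
      obtain d where "c - b = a * d" using \<open>a dvd c - b\<close> by (auto simp: dvd_def)
      hence "\<phi> c - \<phi> b = \<phi> a * \<phi> d" by (simp add: skew_mult_drinfeld flip: drinfeld_diff)
      thus "\<phi> a dvd \<phi> c - \<phi> b" by simp
    qed
    moreover have "a dvd b - b" by simp
    ultimately show ?thesis by blast
  qed
  thus ?thesis by (simp add: torsion_module_def poly_class_eq)
qed

lemma vectorspace_torsion:
  assumes "field (poly_quot a)"
  shows "vectorspace (poly_quot a) (torsion_mod a)"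
proof -
  let ?c = "\<lambda>b. PIdl\<^bsub>class_ring\<^esub> a +>\<^bsub>class_ring\<^esub> b"
  have ops: "?c b \<otimes>\<^bsub>poly_quot a\<^esub> ?c b' = ?c (b * b')" "?c b \<oplus>\<^bsub>poly_quot a\<^esub> ?c b' = ?c (b + b')"
      "\<one>\<^bsub>poly_quot a\<^esub> = ?c 1" for b b'
    using ring_hom_mult[OF poly_class_hom, of b b' a] ring_hom_add[OF poly_class_hom, of b b' a]
      ring_hom_one[OF poly_class_hom, of a] by simp_all
  have [simp]: "x + y \<in> torsion q \<iota> r a" if "x \<in> torsion q \<iota> r a" "y \<in> torsion q \<iota> r a" for x y
    using that by (simp add: torsion_def skew_act_add_right)
  have "- x \<in> torsion q \<iota> r a" if "x \<in> torsion q \<iota> r a" for x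
    using that skew_act_add_right[of "\<phi> a" x "- x"] by (simp add: torsion_def)
  hence [simp]: "\<exists>y\<in>torsion q \<iota> r a. x + y = 0" if "x \<in> torsion q \<iota> r a" for x
    using that by (metis add.right_inverse)
  have [simp]: "0 \<in> torsion q \<iota> r a" by (simp add: torsion_def)
  show ?thesis
    by (rule vs_criteria[OF assms])
      (auto simp: carrier_poly_quot ops torsion_smult skew_act_torsion skew_act_mult skew_act_add_left
        skew_act_add_right)
qed

text \<open>Linearity over A/(a) is the commutation of \<open>u\<close> with every
  \<open>\<phi> b\<close>; compatibility with products is composition of actions.\<close>

lemma torsion_restrict_hom:
  "torsion_restrict q \<iota> r a \<in> Ring.ring_hom (skew_ring q) (End_ring (poly_quot a) (torsion_mod a))"
proof (rule ring_hom_memI)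
  fix u v :: "'k poly"
  have "skew_act q u (skew_act q (\<phi> b) x) = skew_act q (\<phi> b) (skew_act q u x)" for b x
    by (simp add: drinfeld_central flip: skew_act_mult)
  thus "torsion_restrict q \<iota> r a u \<in> carrier (End_ring (poly_quot a) (torsion_mod a))"
    by (auto simp: End_ring_def torsion_restrict_def module_hom_def skew_act_torsion carrier_poly_quot
        torsion_smult skew_act_add_right) (auto simp: torsion_def skew_act_add_right)
  show "torsion_restrict q \<iota> r a (u \<otimes>\<^bsub>skew_ring q\<^esub> v) =
      torsion_restrict q \<iota> r a u \<otimes>\<^bsub>End_ring (poly_quot a) (torsion_mod a)\<^esub> torsion_restrict q \<iota> r a v"
    by (auto simp: End_ring_def torsion_restrict_def compose_def skew_act_torsion skew_act_mult)
  show "torsion_restrict q \<iota> r a (u \<oplus>\<^bsub>skew_ring q\<^esub> v) =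
      torsion_restrict q \<iota> r a u \<oplus>\<^bsub>End_ring (poly_quot a) (torsion_mod a)\<^esub> torsion_restrict q \<iota> r a v"
    by (auto simp: End_ring_def torsion_restrict_def skew_act_add_left)
qed (auto simp: End_ring_def torsion_restrict_def)

lemma Theta_End_class: "Theta_End q \<iota> r a (skew_class q (\<phi> a) u) = torsion_restrict q \<iota> r a u"
proof -
  have "torsion_restrict q \<iota> r a v = torsion_restrict q \<iota> r a u" if "\<phi> a dvd v - u" for v
    using skew_act_cong_dvd[OF that] by (auto simp: torsion_restrict_def)
  moreover have "\<phi> a dvd u - u" by simp
  ultimately have "torsion_restrict q \<iota> r a ` {v. \<phi> a dvd v - u} = {torsion_restrict q \<iota> r a u}"
    by blast
  thus ?thesis by (simp add: Theta_End_def skew_class_eq)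
qed

lemma inj_on_Theta_End:
  assumes "coeff a 0 \<noteq> 0"
  shows "inj_on (Theta_End q \<iota> r a) (carrier (skew_quot q (\<phi> a)))"
proof (rule inj_onI)
  fix C D assume "C \<in> carrier (skew_quot q (\<phi> a))" "D \<in> carrier (skew_quot q (\<phi> a))"
    and eq: "Theta_End q \<iota> r a C = Theta_End q \<iota> r a D"
  then obtain u v where uv: "C = skew_class q (\<phi> a) u" "D = skew_class q (\<phi> a) v"
    by (auto simp: carrier_skew_quot)
  have "skew_act q (u - v) x = 0" if "x \<in> torsion q \<iota> r a" for x
    using eq that by (auto simp: uv Theta_End_class torsion_restrict_def skew_act_diff fun_eq_iff restrict_def split: if_splits)
  hence "\<phi> a dvd u - v" by (simp flip: skew_act_torsion_eq_0_iff[OF assms])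
  thus "C = D" by (simp add: uv skew_class_eq_iff)
qed

lemma Theta_End_hom:
  "Theta_End q \<iota> r a \<in> Ring.ring_hom (skew_quot q (\<phi> a)) (End_ring (poly_quot a) (torsion_mod a))"
  by (rule ring_hom_skew_quot[OF torsion_restrict_hom Theta_End_class])

end

section \<open>Surjectivity by counting, for a chosen basis of the torsion\<close>

locale torsion_basis = finite_drinfeld q \<iota> r
  for q :: nat and \<iota> :: "'f::{field,finite} \<Rightarrow> 'k::{field,finite}" and r :: nat +
  fixes a :: "'f poly" and \<chi> :: "'f poly set \<Rightarrow> 'e::{field,finite}" and bs :: "'k alg_closure list"
  assumes coeff_0: "coeff a 0 \<noteq> 0" and degree_pos: "1 \<le> degree a" and card_e: "CARD('e) = q ^ degree a"
    and \<chi>: "\<chi> \<in> ring_iso (poly_quot a) class_ring"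
    and distinct_bs: "distinct bs"
    and basis_bs: "vectorspace.basis (poly_quot a) (torsion_mod a) (set bs)"
begin

lemma field_poly_quot: "field (poly_quot a)"
  using \<chi> ideal.quotient_is_ring[OF ideal_poly] class_field by (rule field_of_ring_iso)

sublocale T: vectorspace "poly_quot a" "torsion_mod a"
  by (rule vectorspace_torsion[OF field_poly_quot])

text \<open>With d the degree of \<open>a\<close>, the torsion has q^(r d) elements and the scalar
  field q^d, so the length of any basis is forced.\<close>

lemma length_bs: "length bs = r"
proof -
  have "card (carrier (poly_quot a)) = q ^ degree a"
    using bij_betw_same_card[OF ring_iso_memE(5)[OF \<chi>]] by (simp add: card_e)
  hence "q ^ (r * degree a) = q ^ (degree a * length bs)"
    using T.card_carrier_basis[OF finite_set basis_bs] distinct_bs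
    by (simp add: card_torsion[OF coeff_0] distinct_card power_mult)
  thus ?thesis using q_ge_2 degree_pos by (simp add: power_inject_exp)
qed

abbreviation "E \<equiv> End_ring (poly_quot a) (torsion_mod a)"
abbreviation "mat_of \<equiv> torsion_matrix q \<iota> r a \<chi> bs"

lemma mat_of_hom: "mat_of \<in> Ring.ring_hom E (ring_mat TYPE('e) r ())"
  using T.matrix_of_endo_hom[OF _ distinct_bs basis_bs, of \<chi>] \<chi> by (simp add: length_bs ring_iso_def)

lemma inj_on_mat_of: "inj_on mat_of (carrier E)"
  by (rule T.matrix_of_endo_inj[OF _ basis_bs]) (use ring_iso_memE(5)[OF \<chi>] in \<open>simp add: bij_betw_def\<close>)

text \<open>
  With \<open>d = deg a\<close>, both the quotient and the matrix ring have \<open>q\<close> to the power \<open>d * r * r\<close> elements,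
  so the injective maps in between are onto.
\<close>

lemma mat_of_Theta_End_image: "mat_of ` Theta_End q \<iota> r a ` carrier (skew_quot q (\<phi> a)) = carrier_mat r r"
proof (rule card_subset_eq)
  have sub: "Theta_End q \<iota> r a ` carrier (skew_quot q (\<phi> a)) \<subseteq> carrier E"
    using ring_hom_closed[OF Theta_End_hom] by blast
  show "finite (carrier_mat r r :: 'e mat set)"
    by (rule card_ge_0_finite) (simp add: card_carrier_mat)
  show "mat_of ` Theta_End q \<iota> r a ` carrier (skew_quot q (\<phi> a)) \<subseteq> carrier_mat r r"
    using sub ring_hom_closed[OF mat_of_hom] by (auto simp: ring_mat_simps)
  have "a \<noteq> 0" using coeff_0 by auto
  have "card (mat_of ` Theta_End q \<iota> r a ` carrier (skew_quot q (\<phi> a))) = card (carrier (skew_quot q (\<phi> a)))"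
    using inj_on_subset[OF inj_on_mat_of sub] inj_on_Theta_End[OF coeff_0] by (simp add: card_image)
  also have "\<dots> = CARD('e) ^ (r * r)"
    using \<open>a \<noteq> 0\<close> by (simp add: card_skew_quot card_k card_e mult_ac flip: power_mult)
  finally show "card (mat_of ` Theta_End q \<iota> r a ` carrier (skew_quot q (\<phi> a))) = card (carrier_mat r r :: 'e mat set)"
    by (simp add: card_carrier_mat)
qed

text \<open>Matrices coming from skew polynomials already exhaust all matrices, and they are
  matrices of endomorphisms.\<close>

lemma mat_of_iso: "mat_of \<in> ring_iso E (ring_mat TYPE('e) r ())"
proof -
  have "mat_of ` carrier E = carrier_mat r r"
  proof
    show "mat_of ` carrier E \<subseteq> carrier_mat r r"
      using ring_hom_closed[OF mat_of_hom] by (auto simp: ring_mat_simps)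
    show "carrier_mat r r \<subseteq> mat_of ` carrier E"
      unfolding mat_of_Theta_End_image[symmetric]
      using ring_hom_closed[OF Theta_End_hom] by (intro image_mono) auto
  qed
  thus ?thesis using mat_of_hom inj_on_mat_of by (simp add: ring_iso_def bij_betw_def ring_mat_simps)
qed

text \<open>An endomorphism has the same matrix as the restriction of some skew polynomial;
  injectivity of \<open>mat_of\<close> on \<open>E\<close> then identifies the two.\<close>

lemma Theta_End_iso: "Theta_End q \<iota> r a \<in> ring_iso (skew_quot q (\<phi> a)) E"
proof -
  have sub: "Theta_End q \<iota> r a ` carrier (skew_quot q (\<phi> a)) \<subseteq> carrier E"
    using ring_hom_closed[OF Theta_End_hom] by blast
  have "Theta_End q \<iota> r a ` carrier (skew_quot q (\<phi> a)) = carrier E"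
  proof (rule antisym[OF sub], rule subsetI)
    fix f assume f: "f \<in> carrier E"
    hence "mat_of f \<in> mat_of ` Theta_End q \<iota> r a ` carrier (skew_quot q (\<phi> a))"
      using mat_of_Theta_End_image ring_hom_closed[OF mat_of_hom] by (auto simp: ring_mat_simps)
    thus "f \<in> Theta_End q \<iota> r a ` carrier (skew_quot q (\<phi> a))"
      using inj_on_image_mem_iff[OF inj_on_mat_of f sub] by simp
  qed
  thus ?thesis
    using Theta_End_hom inj_on_Theta_End[OF coeff_0] by (simp add: ring_iso_def bij_betw_def)
qed

end

section \<open>The skew Chinese remainder theorem\<close>

lemma monic_dvd_antisym:
  fixes p s :: "'a::idom poly"
  assumes "p dvd s" "s dvd p" "lead_coeff p = 1" "lead_coeff s = 1"
  shows "p = s"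
proof -
  obtain e where e: "s = p * e" using assms(1) by (auto simp: dvd_def)
  have nz: "p \<noteq> 0" "e \<noteq> 0" using e assms(3,4) by auto
  hence "degree s = degree p + degree e" by (simp add: e degree_mult_eq)
  moreover have "degree s \<le> degree p" using assms(2) nz by (intro dvd_imp_degree_le)
  ultimately have "degree e = 0" by simp
  then obtain c where c: "e = [:c:]" by (rule degree_eq_zeroE)
  have "lead_coeff e = 1" using assms(3,4) by (simp add: e lead_coeff_mult)
  thus ?thesis by (simp add: e c)
qed

text \<open>A nonzero element \<open>d\<close> of least degree in the ideal generated by
  \<open>p\<close> and \<open>s\<close> divides both, by division with remainder. If it were not a
  unit, both irreducibles would be associated to \<open>d\<close>, and being monic they would
  coincide.\<close>

lemma irreducible_poly_bezout:
  fixes p s :: "'a::field poly"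
  assumes "irreducible p" "irreducible s" "lead_coeff p = 1" "lead_coeff s = 1" "p \<noteq> s"
  shows "\<exists>a b. a * p + b * s = 1"
proof -
  define I where "I = {a * p + b * s |a b. True}"
  have I: "p \<in> I" "s \<in> I"
    unfolding I_def by (rule CollectI, rule exI[of _ 1], rule exI[of _ 0], simp,
        rule CollectI, rule exI[of _ 0], rule exI[of _ 1], simp)
  have add: "x - c * y \<in> I" if "x \<in> I" "y \<in> I" for x y c
  proof -
    obtain a b a' b' where "x = a * p + b * s" "y = a' * p + b' * s" using \<open>x \<in> I\<close> \<open>y \<in> I\<close> by (auto simp: I_def)
    hence "x - c * y = (a - c * a') * p + (b - c * b') * s" by (simp add: algebra_simps)
    thus ?thesis by (auto simp: I_def)
  qed
  have "p \<in> I \<and> p \<noteq> 0" using I assms(3) by auto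
  from ex_has_least_nat[of "\<lambda>d. d \<in> I \<and> d \<noteq> 0", OF this, of degree]
  obtain d where d: "d \<in> I" "d \<noteq> 0" "\<And>x. x \<in> I \<Longrightarrow> x \<noteq> 0 \<Longrightarrow> degree d \<le> degree x" by blast
  have dvd: "d dvd x" if "x \<in> I" for x
  proof -
    have "x mod d \<in> I" using add[OF \<open>x \<in> I\<close> d(1), of "x div d"] by (simp add: minus_div_mult_eq_mod)
    hence "x mod d = 0" using d(3)[of "x mod d"] degree_mod_less[OF d(2), of x] by force
    thus ?thesis by auto
  qed
  have "is_unit d"
  proof (rule ccontr)
    assume unit: "\<not> is_unit d"
    have assoc: "x dvd d" if "irreducible x" "d dvd x" for x
      using irreducibleD'[OF that] unit by blast
    have "p dvd s" "s dvd p"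
      using assoc[OF assms(1)] assoc[OF assms(2)] dvd[OF I(1)] dvd[OF I(2)] by (auto intro: dvd_trans)
    hence "p = s" using monic_dvd_antisym[of p s] assms(3,4) by simp
    thus False using assms(5) by contradiction
  qed
  then obtain e where "1 = d * e" by (auto simp: dvd_def)
  moreover obtain a b where "d = a * p + b * s" using d(1) by (auto simp: I_def)
  ultimately have "(e * a) * p + (e * b) * s = 1" by (simp add: algebra_simps)
  thus ?thesis by blast
qed

text \<open>Multiply the relation for the head by the one for the tail: all terms but one contain
  \<open>x\<close>, and the remaining one contains the whole product.\<close>

lemma bezout_prod_list:
  fixes x :: "'a::comm_ring_1"
  assumes "\<And>y. y \<in> set ys \<Longrightarrow> \<exists>a b. a * x + b * y = 1"
  shows "\<exists>a b. a * x + b * prod_list ys = 1"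
  using assms
proof (induction ys)
  case Nil
  show ?case by (rule exI[of _ 0], rule exI[of _ 1]) simp
next
  case (Cons y ys)
  then obtain a b c d where *: "a * x + b * y = 1" "c * x + d * prod_list ys = 1" by force
  have "1 = (a * x + b * y) * (c * x + d * prod_list ys)" using * by simp
  also have "\<dots> = (a * c * x + a * d * prod_list ys + b * y * c) * x + (b * d) * prod_list (y # ys)"
    by (simp add: algebra_simps)
  finally show ?case by metis
qed

lemma bezout_mult_dvd:
  fixes x y z :: "'a::comm_ring_1"
  assumes "a * x + b * y = 1" "x dvd z" "y dvd z"
  shows "x * y dvd z"
proof -
  have "z = z * (a * x + b * y)" using assms(1) by simp
  also have "\<dots> = a * (x * z) + b * (z * y)" by (simp add: algebra_simps)
  also have "x * y dvd \<dots>" using assms(2,3) by (intro dvd_add dvd_mult mult_dvd_mono) auto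
  finally show ?thesis .
qed

text \<open>Moduli are values of \<open>f\<close> on a distinct list: distinctness is then checked
  on the irreducibles of A, while the Bezout relations live among their images Q_i.\<close>

context
  fixes f :: "'a \<Rightarrow> 'b::comm_ring_1" and xs :: "'a list"
  assumes dist: "distinct xs"
    and bezout: "\<And>x y. x \<in> set xs \<Longrightarrow> y \<in> set xs \<Longrightarrow> x \<noteq> y \<Longrightarrow> \<exists>a b. a * f x + b * f y = 1"
begin

lemma prod_list_dvd_iff: "prod_list (map f xs) dvd z \<longleftrightarrow> (\<forall>x\<in>set xs. f x dvd z)"
proof
  assume "prod_list (map f xs) dvd z"
  moreover have "f x dvd prod_list (map f xs)" if "x \<in> set xs" for x
    using that by (intro prod_list_dvd) simp
  ultimately show "\<forall>x\<in>set xs. f x dvd z" by (blast intro: dvd_trans)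
next
  assume "\<forall>x\<in>set xs. f x dvd z"
  thus "prod_list (map f xs) dvd z"
    using dist bezout
  proof (induction xs)
    case (Cons x xs)
    then obtain a b where "a * f x + b * prod_list (map f xs) = 1"
      using bezout_prod_list[of "map f xs" "f x"] by fastforce
    moreover have "prod_list (map f xs) dvd z" using Cons by simp
    ultimately show ?case using Cons.prems(1) by (simp add: bezout_mult_dvd)
  qed simp
qed

lemma chinese_remainder_list: "\<exists>u. \<forall>i<length xs. f (xs ! i) dvd u - t i"
  using dist bezout
proof (induction xs arbitrary: t)
  case (Cons x xs)
  then obtain a b where ab: "a * f x + b * prod_list (map f xs) = 1"
    using bezout_prod_list[of "map f xs" "f x"] by fastforce
  obtain u where u: "\<forall>i<length xs. f (xs ! i) dvd u - t (Suc i)"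
    using Cons.IH[of "\<lambda>i. t (Suc i)"] Cons.prems by auto
  \<comment> \<open>By the Bezout relation, \<open>a * f x\<close> is 0 modulo \<open>f x\<close>
    and 1 modulo the remaining moduli. So \<open>w\<close> agrees with \<open>t 0\<close> at the
    head and with \<open>u\<close> on the tail.\<close>
  define w where "w = t 0 + (u - t 0) * (a * f x)"
  have "w - t 0 = (u - t 0) * a * f x" by (simp add: w_def)
  hence "f x dvd w - t 0" by simp
  moreover have "f (xs ! i) dvd w - t (Suc i)" if i: "i < length xs" for i
  proof -
    have "a * f x = 1 - b * prod_list (map f xs)" using ab by (simp add: algebra_simps)
    hence "w = t 0 + (u - t 0) * (1 - b * prod_list (map f xs))" by (simp only: w_def)
    hence eq: "w - t (Suc i) = (u - t (Suc i)) - (u - t 0) * b * prod_list (map f xs)"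
      by (simp add: algebra_simps)
    have "f (xs ! i) dvd prod_list (map f xs)" using i by (intro prod_list_dvd) auto
    thus ?thesis unfolding eq using u i by (intro dvd_diff[OF _ dvd_mult]) auto
  qed
  ultimately show ?case by (intro exI[of _ w]) (auto simp: less_Suc_eq_0_disj)
qed simp

end

lemma monic_prod_list: "(\<And>p. p \<in> set ps \<Longrightarrow> lead_coeff p = 1) \<Longrightarrow> lead_coeff (prod_list ps) = 1"
  for ps :: "'a::idom poly list"
  by (induction ps) (simp_all add: lead_coeff_mult)

lemma degree_prod_list: "(\<And>p. p \<in> set ps \<Longrightarrow> p \<noteq> 0) \<Longrightarrow> degree (prod_list ps) = (\<Sum>p\<leftarrow>ps. degree p)"
  for ps :: "'a::idom poly list"
proof (induction ps)
  case (Cons p ps)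
  hence "prod_list ps \<noteq> 0" by (auto simp: prod_list_zero_iff)
  thus ?case using Cons by (simp add: degree_mult_eq)
qed simp

text \<open>A vanishing constant term means that T divides \<open>p\<close>, and a monic irreducible
  multiple of T is T itself.\<close>

lemma coeff_0_irreducible:
  fixes p :: "'a::field poly"
  assumes "irreducible p" "lead_coeff p = 1" "p \<noteq> [:0, 1:]"
  shows "coeff p 0 \<noteq> 0"
proof
  assume "coeff p 0 = 0"
  hence X: "[:0, 1:] dvd p" using poly_eq_0_iff_dvd[of p 0] by (simp add: poly_0_coeff_0)
  moreover have "\<not> is_unit [:0, 1 :: 'a:]" by (simp add: is_unit_pCons_iff)
  ultimately have "p dvd [:0, 1:]" using irreducibleD'[OF assms(1) X] by blast
  hence "p = [:0, 1:]" using X assms(2) by (intro monic_dvd_antisym) auto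
  thus False using assms(3) by contradiction
qed

text \<open>A power of a number that is at least 2 determines its exponent, so over a finite field
  the size of a space determines its dimension.\<close>

lemma (in vectorspace) dim_eqI_card:
  assumes "finite (carrier V)" "2 \<le> card (carrier K)" "card (carrier V) = card (carrier K) ^ n"
  shows "dim = n"
proof -
  have "fin_dim"
    unfolding fin_dim_def using assms(1) span_is_subset2[of "carrier V"] in_own_span[of "carrier V"] by blast
  then obtain A where A: "finite A" "basis A" using finite_basis_exists by blast
  hence "card (carrier K) ^ card A = card (carrier K) ^ n" using card_carrier_basis assms(3) by simp
  thus ?thesis using assms(2) dim_basis[OF A] by (simp add: power_inject_exp)
qed

context finite_drinfeld
begin

lemma right_dvd_drinfeld: "right_dvd q (\<phi> a) u \<longleftrightarrow> \<phi> a dvd u"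
  by (simp add: right_dvd_def dvd_def skew_mult_drinfeld mult.commute[of "\<phi> a"])

lemma rem_r_drinfeld:
  assumes "a \<noteq> 0"
  shows "rem_r q u (\<phi> a) = u mod \<phi> a"
  unfolding rem_r_def
proof (rule the_equality)
  have "u = (u div \<phi> a) \<star> \<phi> a + u mod \<phi> a" by (simp add: skew_mult_drinfeld)
  thus "(\<exists>B. u = B \<star> \<phi> a + u mod \<phi> a) \<and> (u mod \<phi> a = 0 \<or> degree (u mod \<phi> a) < degree (\<phi> a))"
    using degree_mod_less[of "\<phi> a" u] assms drinfeld_eq_0_iff by blast
next
  fix H assume H: "(\<exists>B. u = B \<star> \<phi> a + H) \<and> (H = 0 \<or> degree H < degree (\<phi> a))"
  hence "u mod \<phi> a = H mod \<phi> a" by (auto simp: skew_mult_drinfeld)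
  thus "H = u mod \<phi> a" using H by (auto simp: mod_poly_less)
qed

text \<open>A common right divisor need not be central. Applying \<open>\<phi>\<close> to the Bezout
  relation and factoring the divisor out on the right still exhibits it as a right divisor of
  1.\<close>

lemma skew_coprime_drinfeld:
  assumes "a * p + b * s = 1"
  shows "skew_coprime q (\<phi> p) (\<phi> s)"
  unfolding skew_coprime_def is_gcrd_def
proof (intro conjI allI impI)
  show "right_dvd q 1 (\<phi> p)" "right_dvd q 1 (\<phi> s)" by (simp_all add: right_dvd_def)
  fix D assume "right_dvd q D (\<phi> p) \<and> right_dvd q D (\<phi> s)"
  then obtain B C where "\<phi> p = B \<star> D" "\<phi> s = C \<star> D" by (auto simp: right_dvd_def)
  hence "1 = (\<phi> a \<star> B + \<phi> b \<star> C) \<star> D"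
    using arg_cong[OF assms, of \<phi>] by (simp add: skew_mult_add_left skew_mult_assoc)
  thus "right_dvd q D 1" by (auto simp: right_dvd_def)
qed simp

lemma drinfeld_prod_list: "\<phi> (prod_list ps) = prod_list (map \<phi> ps)"
  by (induction ps) (simp_all add: drinfeld_mult del: drinfeld_hom(1))

lemma foldr_skew_mult_drinfeld: "foldr (\<star>) (map \<phi> ps) 1 = \<phi> (prod_list ps)"
  by (induction ps) simp_all

end

section \<open>The Chinese remainder isomorphism and its codes\<close>

locale skew_crt = finite_drinfeld q \<iota> r
  for q :: nat and \<iota> :: "'f::{field,finite} \<Rightarrow> 'k::{field,finite}" and r :: nat +
  fixes ps :: "'f poly list"
  assumes distinct_ps: "distinct ps"
    and monic: "p \<in> set ps \<Longrightarrow> lead_coeff p = 1"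
    and irred: "p \<in> set ps \<Longrightarrow> irreducible p"
begin

abbreviation "\<Gamma> \<equiv> map \<phi> ps"
abbreviation "\<PP> \<equiv> \<phi> (prod_list ps)"

lemma nonzero: "p \<in> set ps \<Longrightarrow> p \<noteq> 0"
  using monic by fastforce

lemma bezout: "p \<in> set ps \<Longrightarrow> s \<in> set ps \<Longrightarrow> p \<noteq> s \<Longrightarrow> \<exists>a b. a * p + b * s = 1"
  by (intro irreducible_poly_bezout monic irred)

lemma bezout_drinfeld:
  assumes "p \<in> set ps" "s \<in> set ps" "p \<noteq> s"
  shows "\<exists>a b. a * \<phi> p + b * \<phi> s = 1"
proof -
  obtain a b where ab: "a * p + b * s = 1" using bezout[OF assms] by blast
  have "\<phi> (a * p + b * s) = 1" by (simp only: ab drinfeld_hom(3))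
  hence "\<phi> a * \<phi> p + \<phi> b * \<phi> s = 1" by (simp only: drinfeld_mult drinfeld_hom(2))
  thus ?thesis by blast
qed

lemma modulus_dvd_iff: "\<PP> dvd u \<longleftrightarrow> (\<forall>p\<in>set ps. \<phi> p dvd u)"
  unfolding drinfeld_prod_list by (rule prod_list_dvd_iff[OF distinct_ps bezout_drinfeld])

lemma pairwise_coprime:
  assumes "i < length ps" "j < length ps" "i \<noteq> j"
  shows "skew_coprime q (\<Gamma> ! i) (\<Gamma> ! j)"
proof -
  have "ps ! i \<noteq> ps ! j" using assms distinct_ps by (simp add: nth_eq_iff_index_eq)
  thus ?thesis using bezout[of "ps ! i" "ps ! j"] assms by (auto intro: skew_coprime_drinfeld)
qed

lemma is_lclm: "is_lclm q \<PP> \<Gamma>"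
  using monic_prod_list[OF monic] modulus_dvd_iff[of \<PP>]
  by (auto simp: is_lclm_def right_dvd_drinfeld modulus_dvd_iff lead_coeff_drinfeld simp del: drinfeld_hom)

lemma degree_modulus: "degree \<PP> = (\<Sum>G\<leftarrow>\<Gamma>. degree G)"
  using degree_prod_list[OF nonzero] by (simp add: degree_drinfeld comp_def sum_list_const_mult)

text \<open>The tuple of classes of \<open>u\<close> itself. Reducing \<open>u\<close> first does
  not change a class, so this is \<open>crt_tuple\<close> in a form where the ring laws are visible;
  indexing by position fits maps into a product of rings.\<close>

definition residues :: "'k poly \<Rightarrow> 'k poly set list" where
  "residues u = map (\<lambda>i. skew_class q (\<Gamma> ! i) u) [0..<length ps]"

lemma residues_map: "residues u = map (\<lambda>G. skew_class q G u) \<Gamma>"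
  by (auto simp: residues_def intro!: nth_equalityI)

lemma crt_tuple_eq: "crt_tuple q \<Gamma> u = residues u"
proof -
  have "skew_class q (\<phi> p) (rem_r q u (\<phi> p)) = skew_class q (\<phi> p) u" if "p \<in> set ps" for p
  proof -
    have "\<phi> p dvd u mod \<phi> p - u" by (simp add: dvd_diff_commute[of _ "u mod _"] dvd_minus_mod)
    thus ?thesis using nonzero[OF that] by (simp add: rem_r_drinfeld skew_class_eq_iff)
  qed
  thus ?thesis by (simp add: crt_tuple_def residues_map)
qed

lemma residues_eq_iff: "residues u = residues v \<longleftrightarrow> \<PP> dvd u - v"
  by (simp add: residues_map skew_class_eq_iff modulus_dvd_iff)

lemma residues_hom: "residues \<in> Ring.ring_hom (skew_ring q) (crt_ring q \<Gamma>)"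
  unfolding residues_def[abs_def] crt_ring_def
  by (rule ring_hom_RDirProd_list) (simp_all add: skew_class_hom)

lemma CRT_class: "CRT q \<Gamma> (skew_class q \<PP> u) = residues u"
proof -
  have "crt_tuple q \<Gamma> v = residues u" if "\<PP> dvd v - u" for v
    using that by (simp only: crt_tuple_eq residues_eq_iff)
  hence "crt_tuple q \<Gamma> ` {v. \<PP> dvd v - u} = (\<lambda>_. residues u) ` {v. \<PP> dvd v - u}"
    by (intro image_cong refl) (simp only: mem_Collect_eq)
  also have "\<dots> = {residues u}" by (rule image_constant[of u]) simp
  finally have "crt_tuple q \<Gamma> ` {v. \<PP> dvd v - u} = {residues u}" .
  thus ?thesis by (simp only: CRT_def skew_class_eq the_elem_eq)
qed

text \<open>Representatives of the components, one for each modulus, are glued by the commutative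
  Chinese remainder theorem; the resulting polynomial works for the skew classes because these are
  ordinary congruence classes.\<close>

lemma carrier_crt_ring: "carrier (crt_ring q \<Gamma>) = range residues"
proof
  show "range residues \<subseteq> carrier (crt_ring q \<Gamma>)" using ring_hom_closed[OF residues_hom] by auto
  show "carrier (crt_ring q \<Gamma>) \<subseteq> range residues"
  proof
    fix Y assume "Y \<in> carrier (crt_ring q \<Gamma>)"
    note Y = RDirProd_list_carrier_mem[OF this[unfolded crt_ring_def]]
    have len: "length Y = length ps" using Y(1) by simp
    have "Y ! i \<in> range (skew_class q (\<phi> (ps ! i)))" if "i < length ps" for i
      using Y(2)[of i] that by (simp add: carrier_skew_quot)
    hence "\<forall>i. \<exists>t. i < length ps \<longrightarrow> Y ! i = skew_class q (\<phi> (ps ! i)) t" by blast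
    then obtain t where t: "\<And>i. i < length ps \<Longrightarrow> Y ! i = skew_class q (\<phi> (ps ! i)) (t i)" by metis
    obtain u where "\<forall>i<length ps. \<phi> (ps ! i) dvd u - t i"
      using chinese_remainder_list[where f = \<phi>, OF distinct_ps bezout_drinfeld] by blast
    hence "Y = residues u"
      using len t by (intro nth_equalityI) (auto simp: residues_def skew_class_eq_iff dvd_diff_commute)
    thus "Y \<in> range residues" by simp
  qed
qed

lemma CRT_iso: "CRT q \<Gamma> \<in> ring_iso (skew_quot q \<PP>) (crt_ring q \<Gamma>)"
proof -
  have "inj_on (CRT q \<Gamma>) (carrier (skew_quot q \<PP>))"
  proof (rule inj_onI)
    fix C D assume "C \<in> carrier (skew_quot q \<PP>)" "D \<in> carrier (skew_quot q \<PP>)"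
      and eq: "CRT q \<Gamma> C = CRT q \<Gamma> D"
    then obtain u v where uv: "C = skew_class q \<PP> u" "D = skew_class q \<PP> v"
      by (auto simp only: carrier_skew_quot)
    thus "C = D" using eq by (simp only: CRT_class residues_eq_iff skew_class_eq_iff)
  qed
  moreover have "CRT q \<Gamma> ` carrier (skew_quot q \<PP>) = carrier (crt_ring q \<Gamma>)"
    by (simp add: carrier_skew_quot carrier_crt_ring image_image CRT_class)
  ultimately show ?thesis
    using ring_hom_skew_quot[OF residues_hom CRT_class] by (simp add: ring_iso_def bij_betw_def)
qed

lemma SCRT_eq: "SCRT q \<PP> \<Gamma> n = residues ` {u. u = 0 \<or> degree u < n}"
  by (auto simp: SCRT_def CRT_class)

lemma ring_crt_ring: "ring (crt_ring q \<Gamma>)"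
  unfolding crt_ring_def by (rule RDirProd_list_is_ring) (simp add: ring_skew_quot)

lemma residues_ops:
  "residues u \<otimes>\<^bsub>crt_ring q \<Gamma>\<^esub> residues v = residues (u \<star> v)"
  "residues u \<oplus>\<^bsub>crt_ring q \<Gamma>\<^esub> residues v = residues (u + v)"
  "\<zero>\<^bsub>crt_ring q \<Gamma>\<^esub> = residues 0"
  using ring_hom_mult[OF residues_hom, of u v] ring_hom_add[OF residues_hom, of u v]
    ring_hom_zero[OF residues_hom R.ring_axioms ring_crt_ring] by simp_all

lemma crt_space_simps:
  "carrier (crt_space q \<Gamma>) = range residues" "zero (crt_space q \<Gamma>) = residues 0"
  "residues u \<oplus>\<^bsub>crt_space q \<Gamma>\<^esub> residues v = residues (u + v)"
  "c \<odot>\<^bsub>crt_space q \<Gamma>\<^esub> residues u = residues (Polynomial.smult c u)"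
proof -
  have "c \<odot>\<^bsub>crt_space q \<Gamma>\<^esub> residues u = map (\<lambda>G. skew_class q G [:c:]) \<Gamma> \<otimes>\<^bsub>crt_ring q \<Gamma>\<^esub> residues u"
    by (simp only: crt_space_def module.select_convs)
  thus "c \<odot>\<^bsub>crt_space q \<Gamma>\<^esub> residues u = residues (Polynomial.smult c u)"
    by (simp only: residues_map[symmetric] residues_ops skew_mult_const_left)
qed (simp_all add: crt_space_def carrier_crt_ring residues_ops)

lemma vectorspace_crt_space: "vectorspace class_ring (crt_space q \<Gamma>)"
proof (rule vs_criteria[OF class_field])
  show "\<forall>v\<in>carrier (crt_space q \<Gamma>). \<exists>v'\<in>carrier (crt_space q \<Gamma>). v \<oplus>\<^bsub>crt_space q \<Gamma>\<^esub> v' = \<zero>\<^bsub>crt_space q \<Gamma>\<^esub>"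
  proof
    fix v assume "v \<in> carrier (crt_space q \<Gamma>)"
    then obtain u where "v = residues u" by (auto simp: crt_space_simps)
    thus "\<exists>v'\<in>carrier (crt_space q \<Gamma>). v \<oplus>\<^bsub>crt_space q \<Gamma>\<^esub> v' = \<zero>\<^bsub>crt_space q \<Gamma>\<^esub>"
      by (intro bexI[of _ "residues (- u)"]) (simp_all add: crt_space_simps)
  qed
qed (auto simp: crt_space_simps add_ac smult_add_left smult_add_right)

lemma subspace_SCRT: "VectorSpace.subspace class_ring (SCRT q \<PP> \<Gamma> n) (crt_space q \<Gamma>)"
proof -
  interpret V: vectorspace class_ring "crt_space q \<Gamma>" by (rule vectorspace_crt_space)
  have "submodule class_ring (SCRT q \<PP> \<Gamma> n) (crt_space q \<Gamma>)"
  proof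
    fix v w assume "v \<in> SCRT q \<PP> \<Gamma> n" "w \<in> SCRT q \<PP> \<Gamma> n"
    then obtain u u' where u: "v = residues u" "w = residues u'" "u = 0 \<or> degree u < n" "u' = 0 \<or> degree u' < n"
      by (auto simp: SCRT_eq)
    hence "u + u' = 0 \<or> degree (u + u') < n" using degree_add_less[of u n u'] by auto
    thus "v \<oplus>\<^bsub>crt_space q \<Gamma>\<^esub> w \<in> SCRT q \<PP> \<Gamma> n" using u by (auto simp: SCRT_eq crt_space_simps)
  next
    fix c v assume "v \<in> SCRT q \<PP> \<Gamma> n"
    then obtain u where u: "v = residues u" "u = 0 \<or> degree u < n" by (auto simp: SCRT_eq)
    hence "Polynomial.smult c u = 0 \<or> degree (Polynomial.smult c u) < n" by auto
    thus "c \<odot>\<^bsub>crt_space q \<Gamma>\<^esub> v \<in> SCRT q \<PP> \<Gamma> n" using u by (auto simp: SCRT_eq crt_space_simps)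
  qed (auto simp: SCRT_eq crt_space_simps)
  thus ?thesis by (simp add: subspace_def vectorspace_crt_space)
qed

text \<open>Two polynomials of degree below \<open>n\<close> with the same residues differ by a
  multiple of \<open>\<PP>\<close>, whose degree is at least \<open>n\<close>; hence encoding is
  injective.\<close>

lemma card_SCRT:
  assumes "n \<le> degree \<PP>"
  shows "card (SCRT q \<PP> \<Gamma> n) = CARD('k) ^ n"
proof -
  have "inj_on residues {u. u = 0 \<or> degree u < n}"
  proof (rule inj_onI)
    fix u v assume u: "u \<in> {u. u = 0 \<or> degree u < n}" and v: "v \<in> {u. u = 0 \<or> degree u < n}"
      and "residues u = residues v"
    hence "\<PP> dvd u - v" by (simp only: residues_eq_iff)
    moreover have "u - v = 0 \<or> degree (u - v) < degree \<PP>"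
      using u v assms degree_diff_less[of u n v] by (auto simp del: drinfeld_hom)
    ultimately have "u - v = 0" by (meson dvd_imp_degree_le not_less)
    thus "u = v" by simp
  qed
  thus ?thesis by (simp only: SCRT_eq card_image card_degree_less)
qed

lemma dim_SCRT:
  assumes "n \<le> degree \<PP>"
  shows "vectorspace.dim class_ring ((crt_space q \<Gamma>)\<lparr>carrier := SCRT q \<PP> \<Gamma> n\<rparr>) = n"
proof -
  interpret V: vectorspace class_ring "crt_space q \<Gamma>" by (rule vectorspace_crt_space)
  interpret W: vectorspace class_ring "(crt_space q \<Gamma>)\<lparr>carrier := SCRT q \<PP> \<Gamma> n\<rparr>"
    by (rule V.subspace_is_vs[OF subspace_SCRT])
  \<comment> \<open>The cardinality is known and positive, which yields finiteness of the
    code.\<close>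
  have "0 < CARD('k) ^ n" by simp
  hence "finite (SCRT q \<PP> \<Gamma> n)" by (metis card_SCRT[OF assms] card_ge_0_finite)
  thus ?thesis
    by (intro W.dim_eqI_card) (simp_all add: card_SCRT[OF assms] card_field_ge_2)
qed

end

section \<open>Combining the torsion isomorphisms, the Chinese remainder map and the two
  codes\<close>

theorem proposition4p5:
  fixes \<iota> :: "'f::{field,finite} \<Rightarrow> 'k::{field,finite}"
    and q r m l :: nat
    and \<qq> :: "'f poly list"
    and \<chi> :: "nat \<Rightarrow> 'f poly set \<Rightarrow> 'e::{field,finite}"
    and bs :: "nat \<Rightarrow> 'k alg_closure list"
    and \<Gamma> :: "'k poly list" and \<PP> :: "'k poly" and N :: nat
  assumes "q = CARD('f)" and "field_hom \<iota>"
    and "CARD('k) = q ^ r" and "CARD('e) = q ^ m"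
    and "r \<ge> 1" and "m \<ge> 1" and "l \<ge> 1"
    and "length \<qq> = l" and "distinct \<qq>"
    and "\<forall>p\<in>set \<qq>. lead_coeff p = 1 \<and> irreducible p \<and> degree p = m \<and> p \<noteq> [:0, 1:]"
    and "\<forall>i<l. \<chi> i \<in> ring_iso (poly_quot (\<qq> ! i)) (class_ring :: 'e ring)"
    and "\<forall>i<l. distinct (bs i) \<and>
           vectorspace.basis (poly_quot (\<qq> ! i)) (torsion_module q \<iota> r (\<qq> ! i)) (set (bs i))"
    and "\<Gamma> = map (drinfeld \<iota> r) \<qq>"
    and "\<PP> = drinfeld \<iota> r (prod_list \<qq>)"
    and "N = degree \<PP>"
  shows
    "(\<PP> = foldr (skew_mult q) \<Gamma> 1 \<and> N = m * l * r) \<and>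

     ((\<forall>Q\<in>set \<Gamma>. \<forall>u. skew_mult q Q u = skew_mult q u Q) \<and>
      (\<forall>i<l. \<forall>j<l. i \<noteq> j \<longrightarrow> skew_coprime q (\<Gamma> ! i) (\<Gamma> ! j)) \<and>
      is_lclm q \<PP> \<Gamma> \<and> degree \<PP> = (\<Sum>Q\<leftarrow>\<Gamma>. degree Q) \<and>
      independent_moduli q \<PP> \<Gamma>) \<and>

     (\<forall>i<l.
        (\<forall>u. Theta_End q \<iota> r (\<qq> ! i) (skew_class q (\<Gamma> ! i) u) = torsion_restrict q \<iota> r (\<qq> ! i) u) \<and>
        Theta_End q \<iota> r (\<qq> ! i)
          \<in> ring_iso (skew_quot q (\<Gamma> ! i))
              (End_ring (poly_quot (\<qq> ! i)) (torsion_module q \<iota> r (\<qq> ! i))) \<and>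
        torsion_matrix q \<iota> r (\<qq> ! i) (\<chi> i) (bs i)
          \<in> ring_iso (End_ring (poly_quot (\<qq> ! i)) (torsion_module q \<iota> r (\<qq> ! i)))
              (ring_mat TYPE('e) r ())) \<and>

     ((\<forall>u. CRT q \<Gamma> (skew_class q \<PP> u) = crt_tuple q \<Gamma> u) \<and>
      CRT q \<Gamma> \<in> ring_iso (skew_quot q \<PP>) (crt_ring q \<Gamma>) \<and>
      (\<forall>K. 1 \<le> K \<and> K \<le> N \<longrightarrow>
         VectorSpace.subspace class_ring (SCRT q \<PP> \<Gamma> K) (crt_space q \<Gamma>) \<and>
         vectorspace.dim class_ring ((crt_space q \<Gamma>)\<lparr>carrier := SCRT q \<PP> \<Gamma> K\<rparr>) = K)) \<and>

     (Theta q \<iota> r \<qq> \<chi> bs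
        \<in> ring_iso (crt_ring q \<Gamma>) (RDirProd_list (replicate l (ring_mat TYPE('e) r ()))) \<and>
      (\<forall>t s. 1 \<le> t \<and> t \<le> l * r \<and> s = t * m - 1 \<longrightarrow>
         Theta q \<iota> r \<qq> \<chi> bs ` SCRT q \<PP> \<Gamma> (m * t) = MSRD q \<iota> r \<qq> \<chi> bs s))"
proof -
  interpret skew_crt q \<iota> r \<qq>
    by (intro skew_crt.intro finite_drinfeld.intro skew_crt_axioms.intro) (use assms in auto)
  \<comment> \<open>The locale speaks of the expanded expressions, the statement of the variables
    \<open>\<Gamma>\<close> and \<open>\<PP>\<close>; these equations fold one into the
    other.\<close>
  have \<Gamma>: "map (drinfeld \<iota> r) \<qq> = \<Gamma>" and \<PP>: "drinfeld \<iota> r (prod_list \<qq>) = \<PP>"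
    using assms by simp_all
  have l: "length \<qq> = l" and deg: "\<And>p. p \<in> set \<qq> \<Longrightarrow> degree p = m" using assms by auto
  have \<Gamma>_nth: "\<Gamma> ! i = drinfeld \<iota> r (\<qq> ! i)" if "i < l" for i
    using that l by (simp flip: \<Gamma>)
  have T: "torsion_basis q \<iota> r (\<qq> ! i) (\<chi> i) (bs i)" if "i < l" for i
  proof unfold_locales
    have i: "\<qq> ! i \<in> set \<qq>" using that l by simp
    \<comment> \<open>Being different from T becomes a nonzero constant term, which is what
      separability needs.\<close>
    show "coeff (\<qq> ! i) 0 \<noteq> 0" using i assms by (intro coeff_0_irreducible) auto
    show "1 \<le> degree (\<qq> ! i)" "CARD('e) = q ^ degree (\<qq> ! i)" using deg[OF i] assms by simp_all
  qed (use that assms in auto)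
  have Theta_End_iso: "Theta_End q \<iota> r (\<qq> ! i) \<in> ring_iso (skew_quot q (\<Gamma> ! i))
      (End_ring (poly_quot (\<qq> ! i)) (torsion_module q \<iota> r (\<qq> ! i)))"
    and mat_iso: "torsion_matrix q \<iota> r (\<qq> ! i) (\<chi> i) (bs i)
      \<in> ring_iso (End_ring (poly_quot (\<qq> ! i)) (torsion_module q \<iota> r (\<qq> ! i))) (ring_mat TYPE('e) r ())"
    and Theta_class: "Theta_End q \<iota> r (\<qq> ! i) (skew_class q (\<Gamma> ! i) u) = torsion_restrict q \<iota> r (\<qq> ! i) u"
    if "i < l" for i u
    using torsion_basis.Theta_End_iso[OF T[OF that]] torsion_basis.mat_of_iso[OF T[OF that]]
    by (simp_all add: \<Gamma>_nth[OF that] Theta_End_class)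
  have N: "N = m * l * r"
  proof -
    have "(\<Sum>p\<leftarrow>\<qq>. r * degree p) = (\<Sum>p\<leftarrow>\<qq>. r * m)"
      using deg by (intro arg_cong[where f = sum_list] map_cong) auto
    hence "degree \<PP> = l * (r * m)"
      using degree_modulus by (simp add: degree_drinfeld comp_def l sum_list_triv flip: \<PP>)
    thus ?thesis using assms(15) by (simp add: mult_ac)
  qed
  have Theta_iso: "Theta q \<iota> r \<qq> \<chi> bs
      \<in> ring_iso (crt_ring q \<Gamma>) (RDirProd_list (replicate l (ring_mat TYPE('e) r ())))"
  proof -
    have "(\<lambda>Y. map (\<lambda>i. (torsion_matrix q \<iota> r (\<qq> ! i) (\<chi> i) (bs i) \<circ> Theta_End q \<iota> r (\<qq> ! i)) (Y ! i)) [0..<l])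
      \<in> ring_iso (crt_ring q \<Gamma>) (RDirProd_list (replicate l (ring_mat TYPE('e) r ())))"
      unfolding crt_ring_def
    proof (rule ring_iso_RDirProd_list)
      show "length (map (skew_quot q) \<Gamma>) = l" using l by (simp flip: \<Gamma>)
      fix i assume i: "i < l"
      thus "torsion_matrix q \<iota> r (\<qq> ! i) (\<chi> i) (bs i) \<circ> Theta_End q \<iota> r (\<qq> ! i)
          \<in> ring_iso (map (skew_quot q) \<Gamma> ! i) (replicate l (ring_mat TYPE('e) r ()) ! i)"
        using ring_iso_set_trans[OF Theta_End_iso[OF i] mat_iso[OF i]] l by (simp flip: \<Gamma>)
    qed simp
    thus ?thesis by (simp add: Theta_def[abs_def] l)
  qed
  have Theta_residues: "Theta q \<iota> r \<qq> \<chi> bs (residues u) =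
      map (\<lambda>i. torsion_matrix q \<iota> r (\<qq> ! i) (\<chi> i) (bs i) (torsion_restrict q \<iota> r (\<qq> ! i) u)) [0..<length \<qq>]" for u
    using Theta_class by (simp add: Theta_def residues_def l \<Gamma>)
  have MSRD: "Theta q \<iota> r \<qq> \<chi> bs ` SCRT q \<PP> \<Gamma> (m * t) = MSRD q \<iota> r \<qq> \<chi> bs s"
    if "1 \<le> t" "s = t * m - 1" for t s
  proof -
    \<comment> \<open>Positivity makes the truncated subtraction in \<open>s\<close> exact, so the
      strict bound \<open>m * t\<close> and the weak bound \<open>s\<close> select the same
      polynomials.\<close>
    have "0 < m * t" "s = m * t - 1" using assms(6) that by (simp_all add: mult.commute)
    hence "degree u < m * t \<longleftrightarrow> degree u \<le> s" for u :: "'k poly" by linarith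
    hence "{u :: 'k poly. u = 0 \<or> degree u < m * t} = {u. u = 0 \<or> degree u \<le> s}" by simp
    moreover have "SCRT q \<PP> \<Gamma> (m * t) = residues ` {u. u = 0 \<or> degree u < m * t}"
      using SCRT_eq by (simp only: \<Gamma> \<PP>)
    ultimately have "Theta q \<iota> r \<qq> \<chi> bs ` SCRT q \<PP> \<Gamma> (m * t)
        = (\<lambda>u. Theta q \<iota> r \<qq> \<chi> bs (residues u)) ` {u. u = 0 \<or> degree u \<le> s}"
      by (simp only: image_image)
    also have "\<dots> = MSRD q \<iota> r \<qq> \<chi> bs s"
      \<comment> \<open>Both sides now range over the same polynomials, and \<open>\<Theta>\<close>
        sends the residues of \<open>u\<close> to the matrices of its restrictions.\<close>
      unfolding MSRD_def drinfeld_End_eq Theta_residues by blast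
    finally show ?thesis .
  qed
  note crt = foldr_skew_mult_drinfeld[of \<qq>] pairwise_coprime is_lclm degree_modulus CRT_class
    CRT_iso subspace_SCRT dim_SCRT
  have central: "\<forall>Q\<in>set \<Gamma>. \<forall>u. skew_mult q Q u = skew_mult q u Q"
    by (auto simp: drinfeld_central simp flip: \<Gamma>)
  show ?thesis
    using crt[unfolded \<Gamma> \<PP>] central N Theta_End_iso mat_iso Theta_class Theta_iso MSRD
      assms(15) crt_tuple_eq[unfolded \<Gamma>]
    unfolding independent_moduli_def l by simp
qed

end
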